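(* Let $l,n$ be positive integers. There is an isomorphism of $\mathrm{U}_q(\mathfrak{q}_n)$-supermodule superalgebras $$\bar\tau:\bar{\mathsf{A}}_{l,n}^{\Pi}\rightarrow\bar{\mathsf{A}}_{l,n}$$ such that $$\bar\tau\bigl(\check{\bar T}_-\bigr)=(J\otimes1)\bar T_-,$$ where $\check{\bar T}_-=\sum_{\alpha=-l}^{-1}\sum_{b\in I_{n|n}}E_{b\alpha}\otimes\bar t_{\alpha b}^{\pi}$ and $\bar T_-=\sum_{\alpha=-l}^{-1}\sum_{b\in I_{n|n}}E_{b\alpha}\otimes\bar t_{\alpha b}$ are the generator matrices, $J=\sum_{a\in I_{n|n}}(-1)^{|a|}E_{-a,a}$, and $\bar\tau$ is applied to the second tensor factor.
   Context: **Conventions.** The base field is $\mathbb{C}(q)$. Tensor products of superalgebras use the Koszul sign rule $(x\otimes y)(x'\otimes y')=(-1)^{|y||x'|}xx'\otimes yy'$. For $N\ge1$, $I_{N|N}=\{-N,\dots,-1,1,\dots,N\}$, with $|i|=\bar0$ if $i>0$ and $|i|=\bar1$ if $i<0$. Matrix units $E_{ij}$ (possibly rectangular) have parity $|i|+|j|$. $\xi=q-q^{-1}$; $\varphi(i,j)=(-1)^{|j|}(\delta_{ij}+\delta_{i,-j})$. $V_q$ is the superspace with basis $v_i$, $i\in I_{n|n}$, $|v_i|=|i|$, and $$S=\sum_{i,j\in I_{n|n}}q^{\varphi(i,j)}E_{ii}\otimes E_{jj}+\xi\sum_{i<j}(-1)^{|i|}(E_{ji}+E_{-j,-i})\otimes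 E_{ij}\in\mathrm{End}(V_q)^{\otimes2},$$ with inverse $S^{-1}=\sum_{i,j\in I_{n|n}}q^{-\varphi(i,j)}E_{ii}\otimes E_{jj}-\xi\sum_{i<j}(-1)^{|i|}(E_{ji}+E_{-j,-i})\otimes E_{ij}$. Superscripts indicate tensor positions, and a bracketed position is the one occupied by entries in a superalgebra other than a matrix superalgebra, e.g. $\bar T_-^{1[3]}=\sum E_{b\alpha}\otimes1\otimes\bar t_{\alpha b}$. **$\mathrm{U}_q(\mathfrak{q}_n)$** is the unital associative superalgebra generated by $L_{ij}$ of parity $|i|+|j|$, $i,j\in I_{n|n}$, $i\le j$, with relations $L_{ii}L_{-i,-i}=1=L_{-i,-i}L_{ii}$ and $L^{[1]2}L^{[1]3}S^{23}=S^{23}L^{[1]3}L^{[1]2}$, where $L=\sum_{i\le j}L_{ij}\otimes E_{ij}$ (put $L_{ij}=0$ for $i>j$). It is a Hopf superalgebra with $\Delta(L)=L\otimes L$, i.e. $\Delta(L_{ij})=\sum_k(-1)^{(|i|+|k|)(|k|+|j|)}L_{ik}\otimes L_{kj}$, $\varepsilon(L)=1$, antipode $L\mapsto L^{-1}$. A $\mathrm{U}_q(\mathfrak{q}_n)$-supermodule superalgebra is a unital associative superalgebra $B$ that is a $\mathrm{U}_q(\mathfrak{q}_n)$-supermodule with $u.(ab)=\sum_{(u)}(-1)^{|u_{(2)}||a|}(u_{(1)}.a)(u_{(2)}.b)$ and $u.1=\varepsilon(u)1$. **Matrices.** $R_-=\sum_{i,j=-l}^{-1}q^{-\delta_{ij}}E_{ii}\otimes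 E_{jj}-\xi\sum_{-l\le i<j\le-1}E_{ji}\otimes E_{ij}$ (the submatrix of the $S$-matrix with indices in $I_{l|l}$ involving only negative indices), and $$S_J=(1\otimes J)S(1\otimes J)=-\sum_{a,b\in I_{n|n}}q^{-\varphi(a,b)}E_{aa}\otimes E_{bb}+\xi\sum_{b<a}(-1)^{|a|}(E_{ba}+E_{-b,-a})\otimes E_{ab}.$$ **$\bar{\mathsf{A}}_{l,n}$** (dual quantum coordinate superalgebra): unital associative superalgebra generated by $\bar t_{\alpha b}$ of parity $|\alpha|+|b|$, $\alpha\in I_{l|l}$, $b\in I_{n|n}$, with relations $\bar t_{\alpha b}=(-1)^{|\alpha|+|b|}\bar t_{-\alpha,-b}$ and $\bar T^{1[3]}\bar T^{2[3]}S^{12}=S^{12}\bar T^{2[3]}\bar T^{1[3]}$, where $\bar T=\sum(-1)^{|b|(|\alpha|+|b|)}E_{b\alpha}\otimes\bar t_{\alpha b}$ (the left-hand $S$ has indices in $I_{l|l}$). It is equivalently presented by generators $\bar t_{\alpha b}$, $\alpha=-1,\dots,-l$, $b\in I_{n|n}$, with the relation $\bar T_-^{1[3]}\bar T_-^{2[3]}R_-^{12}=S^{12}\bar T_-^{2[3]}\bar T_-^{1[3]}$. It is a $\mathrm{U}_q(\mathfrak{q}_n)$-supermodule superalgebra with action $\bar\Phi$ determined by $L^{[2]3}\cdot_{\bar\Phi}\bar T^{1[2]}=(S^{-1})^{13}\bar T^{1[2]}$. **$\bar{\mathsf{A}}_{l,n}^{\Pi}$**: unital associative superalgebra with generators $\bar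 t_{\alpha b}^{\pi}$ of parity $|b|$ (that is, $|\alpha|+|b|+\bar1$), $\alpha=-1,\dots,-l$, $b\in I_{n|n}$, and defining relation $\check{\bar T}_-^{1[3]}\check{\bar T}_-^{2[3]}R_-^{12}=S_J^{12}\check{\bar T}_-^{2[3]}\check{\bar T}_-^{1[3]}$. It is a $\mathrm{U}_q(\mathfrak{q}_n)$-supermodule superalgebra with action $\bar\Phi^\pi$ determined by $L^{[2]3}\cdot_{\bar\Phi^\pi}\check{\bar T}_-^{1[2]}=(S^{-1})^{13}\check{\bar T}_-^{1[2]}$. In both cases, for a matrix $M=\sum E_{c\alpha}\otimes m_{c\alpha}$ of generators, $L^{[2]3}\cdot M^{1[2]}$ denotes $\sum(-1)^{(|a|+|b|)|m_{c\alpha}|}E_{c\alpha}\otimes(L_{ab}.m_{c\alpha})\otimes E_{ab}$. *)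

theory Defs
  imports
    "HOL-Library.Poly_Mapping"
    "HOL-Library.Z2"
    "HOL-Computational_Algebra.Polynomial"
    "HOL-Computational_Algebra.Fraction_Field"
    "HOL-Algebra.QuotRing"
    "HOL-Algebra.Algebraic_Closure_Type"
begin

section \<open>The base field \<open>\<complex>(q)\<close> and superalgebras over it\<close>

type_synonym scalar = "complex poly fract"

definition qq :: scalar where "qq = Fract [:0, 1:] 1"

definition xi :: scalar where "xi = qq - inverse qq"

abbreviation scalars :: "scalar ring" where "scalars \<equiv> ring_of_type_algebra"

text \<open>Parities live in the two-element field \<^typ>\<open>bit\<close>; \<open>sg p\<close> is $(-1)^p$.\<close>

definition sg :: "bit \<Rightarrow> scalar" where "sg p = (if p = 0 then 1 else - 1)"

record 'a superalgebra = "(scalar, 'a) module" +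
  part :: "bit \<Rightarrow> 'a set"

definition is_superalgebra :: "'a superalgebra \<Rightarrow> bool" where
  "is_superalgebra B \<longleftrightarrow>
     ring B \<and> module scalars B \<and>
     (\<forall>c. \<forall>x\<in>carrier B. \<forall>y\<in>carrier B.
        c \<odot>\<^bsub>B\<^esub> (x \<otimes>\<^bsub>B\<^esub> y) = (c \<odot>\<^bsub>B\<^esub> x) \<otimes>\<^bsub>B\<^esub> y \<and>
        c \<odot>\<^bsub>B\<^esub> (x \<otimes>\<^bsub>B\<^esub> y) = x \<otimes>\<^bsub>B\<^esub> (c \<odot>\<^bsub>B\<^esub> y)) \<and>
     (\<forall>p. submodule (part B p) scalars B) \<and>
     (\<forall>x\<in>carrier B. \<exists>!(y, z). y \<in> part B 0 \<and> z \<in> part B 1 \<and> x = y \<oplus>\<^bsub>B\<^esub> z) \<and>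
     \<one>\<^bsub>B\<^esub> \<in> part B 0 \<and>
     (\<forall>p r. \<forall>x\<in>part B p. \<forall>y\<in>part B r. x \<otimes>\<^bsub>B\<^esub> y \<in> part B (p + r))"

text \<open>\<open>\<rho> u m\<close> is the action $u.m$ of the superalgebra \<open>U\<close> on the superspace underlying \<open>M\<close>.\<close>

definition supermodule ::
  "'u superalgebra \<Rightarrow> 'a superalgebra \<Rightarrow> ('u \<Rightarrow> 'a \<Rightarrow> 'a) \<Rightarrow> bool" where
  "supermodule U M \<rho> \<longleftrightarrow>
     (\<forall>u\<in>carrier U. \<forall>m\<in>carrier M. \<rho> u m \<in> carrier M) \<and>
     (\<forall>u\<in>carrier U. \<forall>v\<in>carrier U. \<forall>m\<in>carrier M. \<rho> (u \<oplus>\<^bsub>U\<^esub> v) m = \<rho> u m \<oplus>\<^bsub>M\<^esub> \<rho> v m) \<and>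
     (\<forall>c. \<forall>u\<in>carrier U. \<forall>m\<in>carrier M. \<rho> (c \<odot>\<^bsub>U\<^esub> u) m = c \<odot>\<^bsub>M\<^esub> \<rho> u m) \<and>
     (\<forall>u\<in>carrier U. \<forall>m\<in>carrier M. \<forall>m'\<in>carrier M. \<rho> u (m \<oplus>\<^bsub>M\<^esub> m') = \<rho> u m \<oplus>\<^bsub>M\<^esub> \<rho> u m') \<and>
     (\<forall>c. \<forall>u\<in>carrier U. \<forall>m\<in>carrier M. \<rho> u (c \<odot>\<^bsub>M\<^esub> m) = c \<odot>\<^bsub>M\<^esub> \<rho> u m) \<and>
     (\<forall>m\<in>carrier M. \<rho> \<one>\<^bsub>U\<^esub> m = m) \<and>
     (\<forall>u\<in>carrier U. \<forall>v\<in>carrier U. \<forall>m\<in>carrier M. \<rho> (u \<otimes>\<^bsub>U\<^esub> v) m = \<rho> u (\<rho> v m)) \<and>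
     (\<forall>p r. \<forall>u\<in>part U p. \<forall>m\<in>part M r. \<rho> u m \<in> part M (p + r))"

section \<open>Superalgebras presented by generators and relations\<close>

definition idx :: "nat \<Rightarrow> int set" where
  "idx N = {i. i \<noteq> 0 \<and> \<bar>i\<bar> \<le> int N}"

definition neg_idx :: "nat \<Rightarrow> int set" where
  "neg_idx l = {- int l .. - 1}"

definition par :: "int \<Rightarrow> bit" where "par i = (if i < 0 then 1 else 0)"

text \<open>The generators $L_{ij}$, $\bar t_{\alpha b}$ and $\bar t^{\pi}_{\alpha b}$ (in this order).\<close>

datatype gen = Lgen int int | Tgen int int | Pgen int int

fun par_gen :: "gen \<Rightarrow> bit" where
  "par_gen (Lgen i j) = par i + par j"
| "par_gen (Tgen \<alpha> b) = par \<alpha> + par b"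
| "par_gen (Pgen \<alpha> b) = par b"

text \<open>The free monoid, written additively so that \<open>gen word \<Rightarrow>\<^sub>0 scalar\<close> with the
  convolution product of \<open>Poly_Mapping\<close> is the free associative algebra.\<close>

datatype 'g word = Word (letters: "'g list")

instantiation word :: (type) monoid_add
begin

definition zero_word :: "'g word" where "zero_word = Word []"

definition plus_word :: "'g word \<Rightarrow> 'g word \<Rightarrow> 'g word" where
  "plus_word u v = Word (letters u @ letters v)"

instance
  by standard (simp_all add: zero_word_def plus_word_def)

end

definition par_word :: "gen word \<Rightarrow> bit" where
  "par_word w = sum_list (map par_gen (letters w))"

type_synonym free = "gen word \<Rightarrow>\<^sub>0 scalar"

definition scale :: "scalar \<Rightarrow> ('k \<Rightarrow>\<^sub>0 scalar) \<Rightarrow> ('k \<Rightarrow>\<^sub>0 scalar)" where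
  "scale c f = Poly_Mapping.map ((*) c) f"

definition gen_elt :: "gen \<Rightarrow> free" where
  "gen_elt g = Poly_Mapping.single (Word [g]) 1"

definition free_alg :: "gen set \<Rightarrow> free superalgebra" where
  "free_alg G =
    \<lparr> carrier = {f. \<forall>w\<in>Poly_Mapping.keys f. set (letters w) \<subseteq> G},
      monoid.mult = (*), one = 1, ring.zero = 0, add = (+),
      module.smult = scale,
      part = (\<lambda>p. {f. \<forall>w\<in>Poly_Mapping.keys f. set (letters w) \<subseteq> G \<and> par_word w = p}) \<rparr>"

definition rel_ideal :: "gen set \<Rightarrow> free set \<Rightarrow> free set" where
  "rel_ideal G Rel = genideal (free_alg G) Rel"

definition cls :: "gen set \<Rightarrow> free set \<Rightarrow> free \<Rightarrow> free set" where
  "cls G Rel f = rel_ideal G Rel +>\<^bsub>free_alg G\<^esub> f"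

definition presented :: "gen set \<Rightarrow> free set \<Rightarrow> free set superalgebra" where
  "presented G Rel =
    (let Q = free_alg G Quot rel_ideal G Rel in
    \<lparr> carrier = carrier Q,
      monoid.mult = monoid.mult Q, one = one Q, ring.zero = ring.zero Q, add = add Q,
      module.smult = (\<lambda>c Z. \<Union>x\<in>Z. cls G Rel (scale c x)),
      part = (\<lambda>p. cls G Rel ` part (free_alg G) p) \<rparr>)"

section \<open>Tensor products of matrix superalgebras and free superalgebras\<close>

text \<open>An element of a tensor product of (possibly rectangular) matrix superalgebras and free
  superalgebras is a finite linear combination of lists of basis legs: matrix units, words, and
  the unit \<open>One\<close> of whichever factor sits in that position.\<close>

datatype leg = One | E int int | W "gen word"

type_synonym tens = "leg list \<Rightarrow>\<^sub>0 scalar"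

fun par_leg :: "leg \<Rightarrow> bit" where
  "par_leg One = 0"
| "par_leg (E i j) = par i + par j"
| "par_leg (W w) = par_word w"

text \<open>\<open>None\<close> stands for a vanishing product (ill-typed products, which never occur below,
  also get this value).\<close>

fun leg_mult :: "leg \<Rightarrow> leg \<Rightarrow> leg option" where
  "leg_mult One y = Some y"
| "leg_mult x One = Some x"
| "leg_mult (E i j) (E k m) = (if j = k then Some (E i m) else None)"
| "leg_mult (W u) (W v) = Some (W (u + v))"
| "leg_mult _ _ = None"

text \<open>The Koszul exponent of $(x_1\otimes x_2\otimes\cdots)(y_1\otimes y_2\otimes\cdots)$:
  the sum of $|x_i||y_j|$ over $j<i$.\<close>

fun koszul :: "leg list \<Rightarrow> leg list \<Rightarrow> bit" where
  "koszul (x # xs) (y # ys) = sum_list (map par_leg xs) * par_leg y + koszul xs ys"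
| "koszul _ _ = 0"

definition tmult :: "tens \<Rightarrow> tens \<Rightarrow> tens" (infixl "\<bullet>\<^sub>T" 70) where
  "tmult Z Y = (\<Sum>x\<in>Poly_Mapping.keys Z. \<Sum>y\<in>Poly_Mapping.keys Y.
     (case those (map2 leg_mult x y) of
        None \<Rightarrow> 0
      | Some z \<Rightarrow> Poly_Mapping.single z
           (sg (koszul x y) * Poly_Mapping.lookup Z x * Poly_Mapping.lookup Y y)))"

text \<open>\<open>place k ps Z\<close> puts the legs of \<open>Z\<close> into the (increasing, 1-based) positions \<open>ps\<close> of a
  \<open>k\<close>-fold tensor product, e.g. \<open>place 3 [1, 3] Z\<close> is $Z^{13}$.\<close>

definition place_legs :: "nat \<Rightarrow> nat list \<Rightarrow> leg list \<Rightarrow> leg list" where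
  "place_legs k ps xs =
     map (\<lambda>i. case map_of (zip ps xs) i of None \<Rightarrow> One | Some x \<Rightarrow> x) [1..<Suc k]"

definition place :: "nat \<Rightarrow> nat list \<Rightarrow> tens \<Rightarrow> tens" where
  "place k ps Z = (\<Sum>x\<in>Poly_Mapping.keys Z.
     Poly_Mapping.single (place_legs k ps x) (Poly_Mapping.lookup Z x))"

text \<open>\<open>entry Z ms\<close> is the element of the free algebra that accompanies the matrix units \<open>ms\<close>
  (listed by position) in \<open>Z\<close>.\<close>

definition mat_units :: "leg list \<Rightarrow> (int \<times> int) list" where
  "mat_units xs = concat (map (\<lambda>x. case x of E i j \<Rightarrow> [(i, j)] | _ \<Rightarrow> []) xs)"

definition alg_word :: "leg list \<Rightarrow> gen word" where
  "alg_word xs = sum_list (map (\<lambda>x. case x of W w \<Rightarrow> w | _ \<Rightarrow> 0) xs)"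

definition entry :: "tens \<Rightarrow> (int \<times> int) list \<Rightarrow> free" where
  "entry Z ms = (\<Sum>x\<in>{x\<in>Poly_Mapping.keys Z. mat_units x = ms}.
     Poly_Mapping.single (alg_word x) (Poly_Mapping.lookup Z x))"

text \<open>The relations in the free algebra expressed by a matrix equation \<open>Z = Y\<close>.\<close>

definition entry_rels :: "tens \<Rightarrow> tens \<Rightarrow> free set" where
  "entry_rels Z Y = {entry (Z - Y) ms | ms. True}"

section \<open>The matrices\<close>

definition phi :: "int \<Rightarrow> int \<Rightarrow> int" where
  "phi i j = (if j < 0 then - 1 else 1) * (of_bool (i = j) + of_bool (i = - j))"

definition Smat :: "nat \<Rightarrow> tens" where
  "Smat N =
     (\<Sum>i\<in>idx N. \<Sum>j\<in>idx N. Poly_Mapping.single [E i i, E j j] (qq powi phi i j)) +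
     (\<Sum>(i, j)\<in>{(i, j)\<in>idx N \<times> idx N. i < j}.
        Poly_Mapping.single [E j i, E i j] (xi * sg (par i)) +
        Poly_Mapping.single [E (- j) (- i), E i j] (xi * sg (par i)))"

definition Smat_inv :: "nat \<Rightarrow> tens" where
  "Smat_inv N =
     (\<Sum>i\<in>idx N. \<Sum>j\<in>idx N. Poly_Mapping.single [E i i, E j j] (qq powi (- phi i j))) -
     (\<Sum>(i, j)\<in>{(i, j)\<in>idx N \<times> idx N. i < j}.
        Poly_Mapping.single [E j i, E i j] (xi * sg (par i)) +
        Poly_Mapping.single [E (- j) (- i), E i j] (xi * sg (par i)))"

definition Jmat :: "nat \<Rightarrow> tens" where
  "Jmat n = (\<Sum>a\<in>idx n. Poly_Mapping.single [E (- a) a] (sg (par a)))"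

definition SJmat :: "nat \<Rightarrow> tens" where
  "SJmat n = place 2 [2] (Jmat n) \<bullet>\<^sub>T Smat n \<bullet>\<^sub>T place 2 [2] (Jmat n)"

definition Rmat_minus :: "nat \<Rightarrow> tens" where
  "Rmat_minus l =
     (\<Sum>i\<in>neg_idx l. \<Sum>j\<in>neg_idx l.
        Poly_Mapping.single [E i i, E j j] (qq powi (- of_bool (i = j)))) -
     (\<Sum>(i, j)\<in>{(i, j)\<in>neg_idx l \<times> neg_idx l. i < j}.
        Poly_Mapping.single [E j i, E i j] xi)"

definition Lmat :: "nat \<Rightarrow> tens" where
  "Lmat n = (\<Sum>(i, j)\<in>{(i, j)\<in>idx n \<times> idx n. i \<le> j}.
     Poly_Mapping.single [W (Word [Lgen i j]), E i j] 1)"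

definition Tbar :: "nat \<Rightarrow> nat \<Rightarrow> tens" where
  "Tbar l n = (\<Sum>\<alpha>\<in>idx l. \<Sum>b\<in>idx n.
     Poly_Mapping.single [E b \<alpha>, W (Word [Tgen \<alpha> b])] (sg (par b * (par \<alpha> + par b))))"

definition Tbar_minus :: "nat \<Rightarrow> nat \<Rightarrow> tens" where
  "Tbar_minus l n = (\<Sum>\<alpha>\<in>neg_idx l. \<Sum>b\<in>idx n.
     Poly_Mapping.single [E b \<alpha>, W (Word [Tgen \<alpha> b])] 1)"

definition Tcheck_minus :: "nat \<Rightarrow> nat \<Rightarrow> tens" where
  "Tcheck_minus l n = (\<Sum>\<alpha>\<in>neg_idx l. \<Sum>b\<in>idx n.
     Poly_Mapping.single [E b \<alpha>, W (Word [Pgen \<alpha> b])] 1)"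

section \<open>\<open>U\<^sub>q(q\<^sub>n)\<close> and its supermodule superalgebras\<close>

definition U_gens :: "nat \<Rightarrow> gen set" where
  "U_gens n = {Lgen i j | i j. i \<in> idx n \<and> j \<in> idx n \<and> i \<le> j}"

definition U_rels :: "nat \<Rightarrow> free set" where
  "U_rels n =
     {gen_elt (Lgen i i) * gen_elt (Lgen (- i) (- i)) - 1 | i. i \<in> idx n} \<union>
     {gen_elt (Lgen (- i) (- i)) * gen_elt (Lgen i i) - 1 | i. i \<in> idx n} \<union>
     entry_rels
       (place 3 [1, 2] (Lmat n) \<bullet>\<^sub>T place 3 [1, 3] (Lmat n) \<bullet>\<^sub>T place 3 [2, 3] (Smat n))
       (place 3 [2, 3] (Smat n) \<bullet>\<^sub>T place 3 [1, 3] (Lmat n) \<bullet>\<^sub>T place 3 [1, 2] (Lmat n))"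

definition Uq :: "nat \<Rightarrow> free set superalgebra" where
  "Uq n = presented (U_gens n) (U_rels n)"

definition Ucls :: "nat \<Rightarrow> free \<Rightarrow> free set" where
  "Ucls n = cls (U_gens n) (U_rels n)"

definition L_elt :: "nat \<Rightarrow> int \<Rightarrow> int \<Rightarrow> free set" where
  "L_elt n i j = (if i \<le> j then Ucls n (gen_elt (Lgen i j)) else \<zero>\<^bsub>Uq n\<^esub>)"

text \<open>The coproduct and counit are given on the free superalgebra on the $L_{ij}$, as the
  superalgebra homomorphisms extending $\Delta(L_{ij})=\sum_k(-1)^{(|i|+|k|)(|k|+|j|)}L_{ik}\otimes
  L_{kj}$ and $\varepsilon(L_{ij})=\delta_{ij}$; those of $U_q(q_n)$ are induced by them, so the
  image of \<open>coprod f\<close> in $U_q(q_n)\otimes U_q(q_n)$ is $\Delta$ of the class of \<open>f\<close>.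
  Since $L_{ij}=0$ for $i>j$, only $i\le k\le j$ contributes.\<close>

fun coprod_gen :: "gen \<Rightarrow> tens" where
  "coprod_gen (Lgen i j) = (\<Sum>k\<in>{i..j} - {0}.
     Poly_Mapping.single [W (Word [Lgen i k]), W (Word [Lgen k j])]
       (sg ((par i + par k) * (par k + par j))))"
| "coprod_gen _ = 0"

definition coprod_word :: "gen word \<Rightarrow> tens" where
  "coprod_word w =
     foldr (\<lambda>g Z. coprod_gen g \<bullet>\<^sub>T Z) (letters w) (Poly_Mapping.single [W 0, W 0] 1)"

definition coprod :: "free \<Rightarrow> tens" where
  "coprod f = (\<Sum>w\<in>Poly_Mapping.keys f. scale (Poly_Mapping.lookup f w) (coprod_word w))"

fun counit_gen :: "gen \<Rightarrow> scalar" where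
  "counit_gen (Lgen i j) = of_bool (i = j)"
| "counit_gen _ = 0"

definition counit :: "free \<Rightarrow> scalar" where
  "counit f = (\<Sum>w\<in>Poly_Mapping.keys f.
     Poly_Mapping.lookup f w * prod_list (map counit_gen (letters w)))"

fun leg_word :: "leg \<Rightarrow> gen word" where
  "leg_word (W w) = w"
| "leg_word _ = 0"

definition word_cls :: "nat \<Rightarrow> leg \<Rightarrow> free set" where
  "word_cls n x = Ucls n (Poly_Mapping.single (leg_word x) 1)"

text \<open>In the last clause \<open>k = [W u, W v]\<close> runs over the terms $u_{(1)}\otimes u_{(2)}$ of the
  coproduct.\<close>

definition supermodule_superalgebra ::
  "nat \<Rightarrow> 'a superalgebra \<Rightarrow> (free set \<Rightarrow> 'a \<Rightarrow> 'a) \<Rightarrow> bool" where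
  "supermodule_superalgebra n B \<rho> \<longleftrightarrow>
     is_superalgebra B \<and> supermodule (Uq n) B \<rho> \<and>
     (\<forall>f\<in>carrier (free_alg (U_gens n)). \<rho> (Ucls n f) \<one>\<^bsub>B\<^esub> = counit f \<odot>\<^bsub>B\<^esub> \<one>\<^bsub>B\<^esub>) \<and>
     (\<forall>f\<in>carrier (free_alg (U_gens n)). \<forall>p. \<forall>a\<in>part B p. \<forall>b\<in>carrier B.
        \<rho> (Ucls n f) (a \<otimes>\<^bsub>B\<^esub> b) =
        (\<Oplus>\<^bsub>B\<^esub>k\<in>Poly_Mapping.keys (coprod f).
           (Poly_Mapping.lookup (coprod f) k * sg (par_leg (k ! 1) * p)) \<odot>\<^bsub>B\<^esub>
           (\<rho> (word_cls n (k ! 0)) a \<otimes>\<^bsub>B\<^esub> \<rho> (word_cls n (k ! 1)) b)))"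

definition supermodule_superalgebra_iso ::
  "nat \<Rightarrow> 'a superalgebra \<Rightarrow> (free set \<Rightarrow> 'a \<Rightarrow> 'a) \<Rightarrow>
   'b superalgebra \<Rightarrow> (free set \<Rightarrow> 'b \<Rightarrow> 'b) \<Rightarrow> ('a \<Rightarrow> 'b) \<Rightarrow> bool" where
  "supermodule_superalgebra_iso n B \<rho> C \<sigma> \<tau> \<longleftrightarrow>
     \<tau> \<in> ring_iso B C \<and>
     (\<forall>c. \<forall>x\<in>carrier B. \<tau> (c \<odot>\<^bsub>B\<^esub> x) = c \<odot>\<^bsub>C\<^esub> \<tau> x) \<and>
     (\<forall>p. \<tau> ` part B p \<subseteq> part C p) \<and>
     (\<forall>u\<in>carrier (Uq n). \<forall>x\<in>carrier B. \<tau> (\<rho> u x) = \<sigma> u (\<tau> x))"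

section \<open>The dual quantum coordinate superalgebra and its parity-shifted version\<close>

definition A_gens :: "nat \<Rightarrow> nat \<Rightarrow> gen set" where
  "A_gens l n = {Tgen \<alpha> b | \<alpha> b. \<alpha> \<in> idx l \<and> b \<in> idx n}"

definition A_rels :: "nat \<Rightarrow> nat \<Rightarrow> free set" where
  "A_rels l n =
     {gen_elt (Tgen \<alpha> b) - scale (sg (par \<alpha> + par b)) (gen_elt (Tgen (- \<alpha>) (- b))) | \<alpha> b.
        \<alpha> \<in> idx l \<and> b \<in> idx n} \<union>
     entry_rels
       (place 3 [1, 3] (Tbar l n) \<bullet>\<^sub>T place 3 [2, 3] (Tbar l n) \<bullet>\<^sub>T place 3 [1, 2] (Smat l))
       (place 3 [1, 2] (Smat n) \<bullet>\<^sub>T place 3 [2, 3] (Tbar l n) \<bullet>\<^sub>T place 3 [1, 3] (Tbar l n))"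

definition A_bar :: "nat \<Rightarrow> nat \<Rightarrow> free set superalgebra" where
  "A_bar l n = presented (A_gens l n) (A_rels l n)"

definition A_cls :: "nat \<Rightarrow> nat \<Rightarrow> free \<Rightarrow> free set" where
  "A_cls l n = cls (A_gens l n) (A_rels l n)"

definition APi_gens :: "nat \<Rightarrow> nat \<Rightarrow> gen set" where
  "APi_gens l n = {Pgen \<alpha> b | \<alpha> b. \<alpha> \<in> neg_idx l \<and> b \<in> idx n}"

definition APi_rels :: "nat \<Rightarrow> nat \<Rightarrow> free set" where
  "APi_rels l n = entry_rels
     (place 3 [1, 3] (Tcheck_minus l n) \<bullet>\<^sub>T place 3 [2, 3] (Tcheck_minus l n)
        \<bullet>\<^sub>T place 3 [1, 2] (Rmat_minus l))
     (place 3 [1, 2] (SJmat n) \<bullet>\<^sub>T place 3 [2, 3] (Tcheck_minus l n)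
        \<bullet>\<^sub>T place 3 [1, 3] (Tcheck_minus l n))"

definition APi_bar :: "nat \<Rightarrow> nat \<Rightarrow> free set superalgebra" where
  "APi_bar l n = presented (APi_gens l n) (APi_rels l n)"

definition APi_cls :: "nat \<Rightarrow> nat \<Rightarrow> free \<Rightarrow> free set" where
  "APi_cls l n = cls (APi_gens l n) (APi_rels l n)"

text \<open>The actions are characterized by $L^{[2]3}\cdot M^{1[2]}=(S^{-1})^{13}M^{1[2]}$ for the
  generator matrix $M$, compared at each $E_{c\alpha}\otimes(\cdot)\otimes E_{ab}$; the sign on
  the left is $(-1)^{(|a|+|b|)|m_{c\alpha}|}$.\<close>

definition is_Phi_bar :: "nat \<Rightarrow> nat \<Rightarrow> (free set \<Rightarrow> free set \<Rightarrow> free set) \<Rightarrow> bool" where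
  "is_Phi_bar l n \<Phi> \<longleftrightarrow>
     supermodule_superalgebra n (A_bar l n) \<Phi> \<and>
     (\<forall>\<alpha>\<in>idx l. \<forall>c\<in>idx n. \<forall>a\<in>idx n. \<forall>b\<in>idx n.
        sg ((par a + par b) * (par \<alpha> + par c)) \<odot>\<^bsub>A_bar l n\<^esub>
          \<Phi> (L_elt n a b) (A_cls l n (entry (Tbar l n) [(c, \<alpha>)])) =
        A_cls l n (entry (place 3 [1, 3] (Smat_inv n) \<bullet>\<^sub>T place 3 [1, 2] (Tbar l n))
          [(c, \<alpha>), (a, b)]))"

definition is_Phi_bar_pi :: "nat \<Rightarrow> nat \<Rightarrow> (free set \<Rightarrow> free set \<Rightarrow> free set) \<Rightarrow> bool" where
  "is_Phi_bar_pi l n \<Phi> \<longleftrightarrow>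
     supermodule_superalgebra n (APi_bar l n) \<Phi> \<and>
     (\<forall>\<alpha>\<in>neg_idx l. \<forall>c\<in>idx n. \<forall>a\<in>idx n. \<forall>b\<in>idx n.
        sg ((par a + par b) * par c) \<odot>\<^bsub>APi_bar l n\<^esub>
          \<Phi> (L_elt n a b) (APi_cls l n (entry (Tcheck_minus l n) [(c, \<alpha>)])) =
        APi_cls l n (entry (place 3 [1, 3] (Smat_inv n) \<bullet>\<^sub>T place 3 [1, 2] (Tcheck_minus l n))
          [(c, \<alpha>), (a, b)]))"

end

theory Submission
  imports Defs
begin

text \<open>
  The map sends \<open>t\<^sup>\<pi>\<close> with indices \<open>\<alpha>, b\<close> to the \<open>(b, \<alpha>)\<close> entry of \<open>(J \<otimes> 1)T\<close>, which is \<open>\<plusminus>t\<close> with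
  indices \<open>\<alpha>, - b\<close>; it is even because both \<open>J\<close> and the parity shift are odd. Substituting it, each
  defining relation of the shifted algebra becomes, up to sign, a relation of the dual coordinate
  superalgebra with column indices \<open>k, m < 0\<close>, since \<open>S\<close> commutes with \<open>J \<otimes> 1\<close> and \<open>J \<otimes> 1\<close> anticommutes
  with \<open>1 \<otimes> J\<close>. For the inverse one needs the relations with arbitrary column indices: modulo
  \<open>t\<^bsub>\<alpha>b\<^esub> = \<plusminus>t\<^bsub>-\<alpha>,-b\<^esub>\<close> they are literally the ones with \<open>k, m < 0\<close>. Equivariance is inherited by products
  through the coproduct and by products in \<open>U\<^sub>q(q\<^sub>n)\<close> because the span of the generators is stable,
  so it reduces to the action of the \<open>L\<^bsub>ij\<^esub>\<close> on generators, where it is the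
  commutation of \<open>S\<^sup>-\<^sup>1\<close> with \<open>J \<otimes> 1\<close>.
\<close>

text \<open>Tensor products, matrix entries and evaluation of words are all linear extensions of
  maps on basis elements, so each identity comes down to a coefficient times a sign. Often the two
  signs agree only where the coefficient of \<open>S\<close> is nonzero, which suffices because
  \<open>S\<close> is even. Parities therefore stay polynomial expressions over the two-element
  field (hence the simp rules removed here), and exponents are compared by splitting on each parity.
  The obstacle is the second column index. Unlike \<open>J \<otimes> 1\<close>, the matrix
  \<open>1 \<otimes> J\<close> does not commute with \<open>S\<close>, so replacing \<open>m\<close>
  by \<open>- m\<close> changes both sides of a quadratic relation. The two changes are
  \<open>xi\<close> times a flip and its \<open>J\<close>-twist; a flip interchanges the two copies
  of the generator matrix, and for this reason the changes cancel.\<close>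

declare add_bit_eq_xor [simp del] mult_bit_eq_and [simp del]

section \<open>Linear extension\<close>

lemma lookup_scale [simp]: "Poly_Mapping.lookup (scale c f) k = c * Poly_Mapping.lookup f k"
  by (simp add: scale_def Poly_Mapping.map.rep_eq when_def)

lemma scale_single [simp]: "scale c (Poly_Mapping.single k d) = Poly_Mapping.single k (c * d)"
  by (rule poly_mapping_eqI) (simp add: lookup_single when_def)

lemma scale_zero [simp]: "scale c 0 = 0" "scale 0 f = 0"
  by (rule poly_mapping_eqI, simp)+

lemma scale_one [simp]: "scale 1 f = f"
  by (rule poly_mapping_eqI) simp

lemma scale_scale [simp]: "scale c (scale d f) = scale (c * d) f"
  by (rule poly_mapping_eqI) (simp add: mult.assoc)

lemma scale_add_right: "scale c (f + g) = scale c f + scale c g"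
  by (rule poly_mapping_eqI) (simp add: lookup_add algebra_simps)

lemma scale_add_left: "scale (c + d) f = scale c f + scale d f"
  by (rule poly_mapping_eqI) (simp add: lookup_add algebra_simps)

lemma scale_diff_right: "scale c (f - g) = scale c f - scale c g"
  by (rule poly_mapping_eqI) (simp add: lookup_minus algebra_simps)

lemma scale_diff_left: "scale (c - d) f = scale c f - scale d f"
  by (rule poly_mapping_eqI) (simp add: lookup_minus algebra_simps)

lemma scale_minus_left: "scale (- c) f = - scale c f"
  by (rule poly_mapping_eqI) simp

lemma scale_sum: "scale c (sum f A) = (\<Sum>x\<in>A. scale c (f x))"
  by (rule poly_mapping_eqI) (simp add: lookup_sum sum_distrib_left)

lemma scale_eq_single_mult: "scale c (f :: free) = Poly_Mapping.single 0 c * f"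
  by (simp add: scale_def mult_map_scale_conv_mult)

lemma scale_mult_left: "scale c f * g = scale c (f * g :: free)"
  by (simp add: scale_eq_single_mult mult.assoc)

lemma keys_scale: "Poly_Mapping.keys (scale c f) \<subseteq> Poly_Mapping.keys f"
  by (auto simp: in_keys_iff)

lemma poly_mapping_eq_sum_single:
  "(f :: 'k \<Rightarrow>\<^sub>0 scalar) =
    (\<Sum>x\<in>Poly_Mapping.keys f. Poly_Mapping.single x (Poly_Mapping.lookup f x))"
proof (rule poly_mapping_eqI)
  fix k
  show "Poly_Mapping.lookup f k = Poly_Mapping.lookup
    (\<Sum>x\<in>Poly_Mapping.keys f. Poly_Mapping.single x (Poly_Mapping.lookup f x)) k"
    by (simp add: lookup_sum lookup_single when_def in_keys_iff)
qed

lemma poly_mapping_linear_induct [consumes 1, case_names zero single add]: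
  assumes "Poly_Mapping.keys (f :: 'k \<Rightarrow>\<^sub>0 scalar) \<subseteq> S" "P 0"
    and "\<And>w c. w \<in> S \<Longrightarrow> P (Poly_Mapping.single w c)"
    and "\<And>f g. Poly_Mapping.keys f \<subseteq> S \<Longrightarrow> Poly_Mapping.keys g \<subseteq> S \<Longrightarrow> P f \<Longrightarrow> P g \<Longrightarrow> P (f + g)"
  shows "P f"
proof -
  let ?t = "\<lambda>x. Poly_Mapping.single x (Poly_Mapping.lookup f x)"
  have "Poly_Mapping.keys (sum ?t A) \<subseteq> S \<and> P (sum ?t A)" if "finite A" "A \<subseteq> Poly_Mapping.keys f" for A
    using that
  proof (induction A rule: finite_induct)
    case (insert x A)
    then have "x \<in> S" "Poly_Mapping.keys (sum ?t A) \<subseteq> S" "P (sum ?t A)"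
      using assms(1) by auto
    then show ?case
      using insert.hyps assms(3)[of x] assms(4)[of "?t x" "sum ?t A"] keys_add[of "?t x" "sum ?t A"]
      by (auto split: if_splits)
  qed (use assms in simp)
  from this[of "Poly_Mapping.keys f"] show ?thesis
    by (simp flip: poly_mapping_eq_sum_single)
qed

text \<open>One set of linearity rules for \<open>tmult\<close>, \<open>place\<close>,
  \<open>entry\<close> and \<open>subst\<close>: sums over \<open>keys\<close> do not distribute
  over addition by mere unfolding, since keys may cancel.\<close>

definition lin :: "('a \<Rightarrow> 'b \<Rightarrow>\<^sub>0 scalar) \<Rightarrow> ('a \<Rightarrow>\<^sub>0 scalar) \<Rightarrow> ('b \<Rightarrow>\<^sub>0 scalar)" where
  "lin h f = (\<Sum>x\<in>Poly_Mapping.keys f. scale (Poly_Mapping.lookup f x) (h x))"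

lemma lin_superset:
  assumes "finite A" "Poly_Mapping.keys f \<subseteq> A"
  shows "lin h f = (\<Sum>x\<in>A. scale (Poly_Mapping.lookup f x) (h x))"
  unfolding lin_def using assms
  by (intro sum.mono_neutral_left) (auto simp: in_keys_iff)

lemma lin_add: "lin h (f + g) = lin h f + lin h g"
proof -
  let ?A = "Poly_Mapping.keys f \<union> Poly_Mapping.keys g"
  have "lin h (f + g) = (\<Sum>x\<in>?A. scale (Poly_Mapping.lookup (f + g) x) (h x))"
    by (intro lin_superset) (use keys_add[of f g] in auto)
  also have "\<dots> = lin h f + lin h g"
    by (simp add: lookup_add scale_add_left sum.distrib lin_superset[of ?A])
  finally show ?thesis .
qed

lemma lin_scale: "lin h (scale c f) = scale c (lin h f)"
  using lin_superset[OF _ keys_scale, of f h c] by (simp add: lin_def scale_sum)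

lemma lin_zero [simp]: "lin h 0 = 0"
  by (simp add: lin_def)

lemma lin_diff: "lin h (f - g) = lin h f - lin h g"
  using lin_add[of h "f - g" g] by (simp add: algebra_simps)

lemma lin_sum: "lin h (sum f A) = (\<Sum>x\<in>A. lin h (f x))"
  by (induction A rule: infinite_finite_induct) (simp_all add: lin_add)

lemma lin_single [simp]: "lin h (Poly_Mapping.single x c) = scale c (h x)"
  by (simp add: lin_def)

lemma keys_lin: "Poly_Mapping.keys (lin h f) \<subseteq> (\<Union>x\<in>Poly_Mapping.keys f. Poly_Mapping.keys (h x))"
proof
  fix k assume "k \<in> Poly_Mapping.keys (lin h f)"
  then have "(\<Sum>x\<in>Poly_Mapping.keys f. Poly_Mapping.lookup f x * Poly_Mapping.lookup (h x) k) \<noteq> 0"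
    by (simp add: in_keys_iff lin_def lookup_sum)
  then obtain x where "x \<in> Poly_Mapping.keys f" "Poly_Mapping.lookup f x * Poly_Mapping.lookup (h x) k \<noteq> 0"
    by (rule sum.not_neutral_contains_not_neutral)
  then show "k \<in> (\<Union>x\<in>Poly_Mapping.keys f. Poly_Mapping.keys (h x))"
    by (auto simp: in_keys_iff)
qed

lemma lin_map_add: "lin (\<lambda>x. g x + h x) f = lin g f + lin h f"
  by (simp add: lin_def scale_add_right sum.distrib)

lemma lin_map_zero: "lin (\<lambda>x. 0) f = 0"
  by (simp add: lin_def)

lemma lin_map_scale: "lin (\<lambda>x. scale c (h x)) f = scale c (lin h f)"
  by (simp add: lin_def scale_sum mult.commute)

lemma lin_map_sum: "lin (\<lambda>x. \<Sum>y\<in>A. h y x) f = (\<Sum>y\<in>A. lin (h y) f)"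
  by (simp add: lin_def scale_sum sum.swap[of _ A])

section \<open>Substitution in free algebras\<close>

definition subst :: "(gen \<Rightarrow> free) \<Rightarrow> free \<Rightarrow> free" where
  "subst h = lin (\<lambda>w. prod_list (map h (letters w)))"

lemma subst_single: "subst h (Poly_Mapping.single w c) = scale c (prod_list (map h (letters w)))"
  by (simp add: subst_def)

lemma subst_gen_elt [simp]: "subst h (gen_elt g) = h g"
  by (simp add: gen_elt_def subst_single)

lemma subst_linear:
  "subst h 0 = 0" "subst h (f + g) = subst h f + subst h g" "subst h (f - g) = subst h f - subst h g"
  "subst h (scale c f) = scale c (subst h f)" "subst h (sum F A) = (\<Sum>x\<in>A. subst h (F x))"
  by (simp_all add: subst_def lin_add lin_diff lin_scale lin_sum)

lemma subst_one [simp]: "subst h 1 = 1"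
  by (simp flip: single_one add: subst_single zero_word_def)
 
text \<open>The empty word is a two-sided unit of the word monoid and coefficients commute, so
  constants are central although the free algebra is not commutative.\<close>

lemma mult_scale_right: "f * scale c g = scale c (f * g :: free)"
proof -
  have "f * Poly_Mapping.single 0 c = Poly_Mapping.single 0 c * f"
  proof -
    have "(\<Sum>x\<in>A. Poly_Mapping.single x (Poly_Mapping.lookup f x)) * Poly_Mapping.single 0 c =
      Poly_Mapping.single 0 c * (\<Sum>x\<in>A. Poly_Mapping.single x (Poly_Mapping.lookup f x))" for A
      by (simp add: sum_distrib_left sum_distrib_right mult_single mult.commute)
    then show ?thesis
      using poly_mapping_eq_sum_single[of f] by metis
  qed
  then show ?thesis
    by (simp add: scale_eq_single_mult flip: mult.assoc)
qed

lemma subst_mult: "subst h (f * g) = subst h f * subst h g"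
proof -
  have single: "subst h (Poly_Mapping.single u c * Poly_Mapping.single v d) =
      subst h (Poly_Mapping.single u c) * subst h (Poly_Mapping.single v d)" for u v c d
    by (simp add: mult_single subst_single plus_word_def scale_mult_left mult_scale_right mult.commute)
  \<comment> \<open>\<open>F\<close> and \<open>G\<close> hide the expansions of \<open>f\<close>
    and \<open>g\<close> while the product is distributed; the sets of keys are filled in afterwards
    and the sums folded back.\<close>
  have "subst h (sum F A * sum G B) = subst h (sum F A) * subst h (sum G B)"
    if "F = (\<lambda>x. Poly_Mapping.single x (Poly_Mapping.lookup f x))"
       "G = (\<lambda>x. Poly_Mapping.single x (Poly_Mapping.lookup g x))" for F G A B
    by (simp add: sum_product subst_linear single that)
  from this[OF refl refl, of "Poly_Mapping.keys f" "Poly_Mapping.keys g"] show ?thesis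
    by (simp flip: poly_mapping_eq_sum_single)
qed

section \<open>Presented superalgebras\<close>

lemma free_alg_carrier:
  "f \<in> carrier (free_alg G) \<longleftrightarrow> (\<forall>w\<in>Poly_Mapping.keys f. set (letters w) \<subseteq> G)"
  by (simp add: free_alg_def)

lemma free_alg_simps [simp]:
  "monoid.mult (free_alg G) = (*)" "one (free_alg G) = 1"
  "ring.zero (free_alg G) = 0" "add (free_alg G) = (+)" "module.smult (free_alg G) = scale"
  by (simp_all add: free_alg_def)

lemma free_alg_part:
  "f \<in> part (free_alg G) p \<longleftrightarrow>
    f \<in> carrier (free_alg G) \<and> (\<forall>w\<in>Poly_Mapping.keys f. par_word w = p)"
  by (auto simp: free_alg_def)

lemma free_alg_closed:
  "0 \<in> carrier (free_alg G)" "1 \<in> carrier (free_alg G)"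
  "set (letters w) \<subseteq> G \<Longrightarrow> Poly_Mapping.single w c \<in> carrier (free_alg G)"
  "g \<in> G \<Longrightarrow> gen_elt g \<in> carrier (free_alg G)"
  by (auto simp: free_alg_carrier zero_word_def gen_elt_def)

lemma free_alg_add_closed:
  "f \<in> carrier (free_alg G) \<Longrightarrow> f' \<in> carrier (free_alg G) \<Longrightarrow> f + f' \<in> carrier (free_alg G)"
  using keys_add[of f f'] by (auto simp: free_alg_carrier)

lemma free_alg_mult_closed:
  "f \<in> carrier (free_alg G) \<Longrightarrow> f' \<in> carrier (free_alg G) \<Longrightarrow> f * f' \<in> carrier (free_alg G)"
  using keys_mult[of f f'] by (fastforce simp: free_alg_carrier plus_word_def)

lemma free_alg_scale_closed: "f \<in> carrier (free_alg G) \<Longrightarrow> scale c f \<in> carrier (free_alg G)"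
  using keys_scale[of c f] by (auto simp: free_alg_carrier)

lemma free_alg_uminus_closed:
  "f \<in> carrier (free_alg G) \<Longrightarrow> - f \<in> carrier (free_alg G)"
  using free_alg_scale_closed[of f G "- 1"] by (simp add: scale_minus_left)

lemma free_alg_diff_closed:
  "f \<in> carrier (free_alg G) \<Longrightarrow> f' \<in> carrier (free_alg G) \<Longrightarrow> f - f' \<in> carrier (free_alg G)"
  using free_alg_add_closed[of f G "- f'"] free_alg_uminus_closed[of f' G] by simp

lemma free_alg_sum_closed:
  "(\<And>x. x \<in> A \<Longrightarrow> F x \<in> carrier (free_alg G)) \<Longrightarrow> sum F A \<in> carrier (free_alg G)"
  by (induction A rule: infinite_finite_induct)
    (auto intro: free_alg_closed free_alg_add_closed)

lemmas free_alg_intros = free_alg_closed free_alg_add_closed free_alg_mult_closed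
  free_alg_scale_closed free_alg_uminus_closed free_alg_diff_closed free_alg_sum_closed

lemma free_alg_ring: "ring (free_alg G)"
proof (rule ringI)
  show "abelian_group (free_alg G)"
  proof (rule abelian_groupI)
    fix x assume "x \<in> carrier (free_alg G)"
    then show "\<exists>y\<in>carrier (free_alg G). y \<oplus>\<^bsub>free_alg G\<^esub> x = \<zero>\<^bsub>free_alg G\<^esub>"
      by (intro bexI[of _ "- x"]) (auto intro: free_alg_intros)
  qed (auto simp: ac_simps intro: free_alg_intros)
  show "Group.monoid (free_alg G)"
    by (rule monoidI)
      (auto simp: mult.assoc intro: free_alg_intros)
qed (auto simp: distrib_left distrib_right)

text \<open>Coset lemmas speak of the difference of the ring record; this turns it into the
  difference of polynomial mappings.\<close>

lemma free_alg_minus: "f \<in> carrier (free_alg G) \<Longrightarrow> g \<in> carrier (free_alg G) \<Longrightarrow>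
    f \<ominus>\<^bsub>free_alg G\<^esub> g = f - g"
proof -
  interpret ring "free_alg G" by (rule free_alg_ring)
  assume fg: "f \<in> carrier (free_alg G)" "g \<in> carrier (free_alg G)"
  then have "\<ominus>\<^bsub>free_alg G\<^esub> g = - g"
    by (intro minus_equality) (simp_all add: free_alg_uminus_closed)
  then show ?thesis
    by (simp add: a_minus_def)
qed

lemma free_alg_induct [consumes 1, case_names zero single add]:
  assumes "f \<in> carrier (free_alg G)" "P 0"
    and "\<And>w c. set (letters w) \<subseteq> G \<Longrightarrow> P (Poly_Mapping.single w c)"
    and "\<And>f g. f \<in> carrier (free_alg G) \<Longrightarrow> g \<in> carrier (free_alg G) \<Longrightarrow> P f \<Longrightarrow> P g \<Longrightarrow> P (f + g)"
  shows "P f"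
proof -
  have carrier: "f \<in> carrier (free_alg G) \<longleftrightarrow> Poly_Mapping.keys f \<subseteq> {w. set (letters w) \<subseteq> G}" for f
    by (auto simp: free_alg_carrier)
  show ?thesis
    using assms(1) unfolding carrier
    by (induction rule: poly_mapping_linear_induct) (simp_all add: assms(2-) carrier)
qed

lemma subst_closed:
  assumes "f \<in> carrier (free_alg G)" "\<And>g. g \<in> G \<Longrightarrow> h g \<in> carrier (free_alg G')"
  shows "subst h f \<in> carrier (free_alg G')"
  using assms(1)
proof (induction rule: free_alg_induct)
  case (single w c)
  have "prod_list (map h u) \<in> carrier (free_alg G')" if "set u \<subseteq> G" for u
    using that by (induction u) (auto intro!: free_alg_intros assms(2))
  with single show ?case
    by (auto simp: subst_single intro!: free_alg_intros)
qed (auto simp: subst_linear intro: free_alg_intros)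

lemma subst_ring_hom:
  assumes "\<And>g. g \<in> G \<Longrightarrow> h g \<in> carrier (free_alg G')"
  shows "ring_hom_ring (free_alg G) (free_alg G') (subst h)"
  by (intro ring_hom_ringI2 free_alg_ring ring_hom_memI)
    (use assms in \<open>simp_all add: subst_closed subst_linear subst_mult\<close>)

lemma prod_list_part:
  assumes "\<And>g. g \<in> set u \<Longrightarrow> h g \<in> part (free_alg G) (p g)"
  shows "prod_list (map h u) \<in> part (free_alg G) (sum_list (map p u))"
  using assms
proof (induction u)
  case Nil
  then show ?case by (auto simp: free_alg_part zero_word_def par_word_def intro: free_alg_closed)
next
  case (Cons g u)
  have mult: "f * f' \<in> part (free_alg G) (r + r')"
    if "f \<in> part (free_alg G) r" "f' \<in> part (free_alg G) r'" for f f' r r'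
    using that keys_mult[of f f'] free_alg_mult_closed[of f G f']
    by (fastforce simp: free_alg_part par_word_def plus_word_def)
  from Cons show ?case
    by (auto intro!: mult)
qed

lemma subst_part:
  assumes f: "f \<in> part (free_alg G) p"
    and h: "\<And>g. g \<in> G \<Longrightarrow> h g \<in> part (free_alg G') (par_gen g)"
  shows "subst h f \<in> part (free_alg G') p"
proof -
  have "prod_list (map h (letters w)) \<in> part (free_alg G') p" if "w \<in> Poly_Mapping.keys f" for w
  proof -
    from that f have "set (letters w) \<subseteq> G" "par_word w = p"
      by (auto simp: free_alg_part free_alg_carrier)
    then show ?thesis
      using prod_list_part[of "letters w" h G' par_gen] h by (auto simp: par_word_def)
  qed
  then have "subst h f \<in> carrier (free_alg G') \<and> (\<forall>w\<in>Poly_Mapping.keys (subst h f). par_word w = p)"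
    using keys_lin[of "\<lambda>w. prod_list (map h (letters w))" f]
    by (fastforce simp: subst_def free_alg_part free_alg_carrier)
  then show ?thesis
    by (simp add: free_alg_part)
qed

section \<open>Quotients of free superalgebras by the ideal of relations\<close>

locale presentation =
  fixes G :: "gen set" and Rel :: "free set"
  assumes rels: "Rel \<subseteq> carrier (free_alg G)"
begin

abbreviation "FF \<equiv> free_alg G"
abbreviation "II \<equiv> rel_ideal G Rel"
abbreviation "QQ \<equiv> presented G Rel"
abbreviation "cl \<equiv> cls G Rel"

sublocale F: ring FF by (rule free_alg_ring)

sublocale I: ideal II FF
  unfolding rel_ideal_def by (rule F.genideal_ideal[OF rels])

lemma rel_in_ideal: "f \<in> Rel \<Longrightarrow> f \<in> II"
  unfolding rel_ideal_def using F.genideal_self[OF rels] by blast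

lemma ideal_zero: "0 \<in> II"
  using I.zero_closed by simp

lemma ideal_add: "f \<in> II \<Longrightarrow> g \<in> II \<Longrightarrow> f + g \<in> II"
  using I.a_closed by simp

lemma ideal_mult: "f \<in> II \<Longrightarrow> g \<in> carrier FF \<Longrightarrow> f * g \<in> II" "f \<in> II \<Longrightarrow> g \<in> carrier FF \<Longrightarrow> g * f \<in> II"
  using I.I_r_closed I.I_l_closed by (simp_all)

text \<open>\<open>genideal\<close> only yields a two-sided ring ideal. It is also a linear subspace
  because scaling is multiplication by a constant of the free algebra.\<close>

lemma ideal_scale: "f \<in> II \<Longrightarrow> scale c f \<in> II"
  unfolding scale_eq_single_mult
  by (intro ideal_mult free_alg_closed) (simp_all add: zero_word_def)

lemma cl_eq_iff:
  assumes "f \<in> carrier FF" "g \<in> carrier FF"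
  shows "cl f = cl g \<longleftrightarrow> f - g \<in> II"
proof -
  have "cl f = cl g \<longleftrightarrow> f \<in> cl g"
    using assms I.a_repr_independence' I.a_rcos_self unfolding cls_def by metis
  also have "\<dots> \<longleftrightarrow> f \<ominus>\<^bsub>FF\<^esub> g \<in> II"
    unfolding cls_def using assms by (intro I.a_rcos_module_minus F.ring_axioms)
  finally show ?thesis
    using assms by (simp add: free_alg_minus)
qed

lemma cl_self: "f \<in> carrier FF \<Longrightarrow> f \<in> cl f"
  unfolding cls_def by (rule I.a_rcos_self)

lemma mem_cl_iff: "f \<in> carrier FF \<Longrightarrow> x \<in> cl f \<longleftrightarrow> x \<in> carrier FF \<and> cl x = cl f"
  using I.a_repr_independence' I.a_elemrcos_carrier cl_self unfolding cls_def by metis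

lemma carrier_presented: "carrier QQ = cl ` carrier FF"
  by (auto simp: presented_def Let_def FactRing_def A_RCOSETS_def' cls_def)

lemma cl_closed: "f \<in> carrier FF \<Longrightarrow> cl f \<in> carrier QQ"
  by (simp add: carrier_presented)

lemma part_presented: "part QQ p = cl ` part FF p"
  by (simp add: presented_def Let_def)

lemma cl_add: "f \<in> carrier FF \<Longrightarrow> g \<in> carrier FF \<Longrightarrow> cl f \<oplus>\<^bsub>QQ\<^esub> cl g = cl (f + g)"
  using I.a_rcos_sum[of f g]
  by (simp add: presented_def Let_def FactRing_def cls_def)

lemma cl_mult: "f \<in> carrier FF \<Longrightarrow> g \<in> carrier FF \<Longrightarrow> cl f \<otimes>\<^bsub>QQ\<^esub> cl g = cl (f * g)"
  using I.rcoset_mult_add[of f g]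
  by (simp add: presented_def Let_def FactRing_def cls_def)

lemma cl_one: "\<one>\<^bsub>QQ\<^esub> = cl 1"
  by (simp add: presented_def Let_def FactRing_def cls_def)

text \<open>\<open>presented\<close> defines the scalar action as a union over all representatives
  of a coset. The union is a single coset since the ideal is stable under scaling.\<close>

lemma cl_scale:
  assumes "f \<in> carrier FF"
  shows "c \<odot>\<^bsub>QQ\<^esub> cl f = cl (scale c f)"
proof -
  have "cl (scale c x) = cl (scale c f)" if "x \<in> cl f" for x
    using that assms ideal_scale[of "x - f" c]
    by (auto simp: mem_cl_iff cl_eq_iff free_alg_scale_closed scale_diff_right)
  then have "(\<Union>x\<in>cl f. cl (scale c x)) = cl (scale c f)"
    using cl_self[OF assms] by blast
  then show ?thesis
    by (simp add: presented_def Let_def)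
qed

end

section \<open>Matrix entries\<close>

definition tleg :: "leg list \<Rightarrow> leg list \<Rightarrow> tens" where
  "tleg x y = (case those (map2 leg_mult x y) of
     None \<Rightarrow> 0 | Some z \<Rightarrow> Poly_Mapping.single z (sg (koszul x y)))"

lemma tmult_eq_lin: "Z \<bullet>\<^sub>T Y = lin (\<lambda>x. lin (tleg x) Y) Z"
  unfolding tmult_def lin_def tleg_def scale_sum
  by (intro sum.cong refl) (simp split: option.split add: ac_simps)

lemma tmult_linear:
  "0 \<bullet>\<^sub>T Y = 0" "Z \<bullet>\<^sub>T 0 = 0"
  "(Z + Z') \<bullet>\<^sub>T Y = Z \<bullet>\<^sub>T Y + Z' \<bullet>\<^sub>T Y" "Z \<bullet>\<^sub>T (Y + Y') = Z \<bullet>\<^sub>T Y + Z \<bullet>\<^sub>T Y'"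
  "scale c Z \<bullet>\<^sub>T Y = scale c (Z \<bullet>\<^sub>T Y)" "Z \<bullet>\<^sub>T scale c Y = scale c (Z \<bullet>\<^sub>T Y)"
  by (simp_all add: tmult_eq_lin lin_add lin_map_add lin_map_zero lin_scale lin_map_scale)

lemma tmult_sum:
  "sum f A \<bullet>\<^sub>T Y = (\<Sum>x\<in>A. f x \<bullet>\<^sub>T Y)" "Z \<bullet>\<^sub>T sum g B = (\<Sum>y\<in>B. Z \<bullet>\<^sub>T g y)"
  by (simp_all add: tmult_eq_lin lin_sum lin_map_sum)

lemma tmult_single:
  "Poly_Mapping.single x c \<bullet>\<^sub>T Poly_Mapping.single y d = scale (c * d) (tleg x y)"
  by (simp add: tmult_eq_lin)

lemma place_eq_lin: "place k ps Z = lin (\<lambda>x. Poly_Mapping.single (place_legs k ps x) 1) Z"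
  by (simp add: place_def lin_def)

lemma place_linear:
  "place k ps (sum f A) = (\<Sum>x\<in>A. place k ps (f x))"
  "place k ps (Poly_Mapping.single x c) = Poly_Mapping.single (place_legs k ps x) c"
  by (simp_all add: place_eq_lin lin_sum)

lemma entry_eq_lin:
  "entry Z ms = lin (\<lambda>x. if mat_units x = ms then Poly_Mapping.single (alg_word x) 1 else 0) Z"
  unfolding entry_def lin_def by (intro sum.mono_neutral_cong_left) auto

lemma entry_linear:
  "entry 0 ms = 0" "entry (Z + Y) ms = entry Z ms + entry Y ms" "entry (Z - Y) ms = entry Z ms - entry Y ms"
  "entry (scale c Z) ms = scale c (entry Z ms)" "entry (sum f A) ms = (\<Sum>x\<in>A. entry (f x) ms)"
  "entry (Poly_Mapping.single x c) ms = (if mat_units x = ms then Poly_Mapping.single (alg_word x) c else 0)"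
  by (simp_all add: entry_eq_lin lin_add lin_diff lin_scale lin_sum)

lemma place_legs_eval:
  "place_legs 3 [1, 2] [x, y] = [x, y, One]"
  "place_legs 3 [1, 3] [x, y] = [x, One, y]"
  "place_legs 3 [2, 3] [x, y] = [One, x, y]"
  "place_legs 2 [1] [x] = [x, One]"
  "place_legs 2 [2] [x] = [One, x]"
  by (simp_all add: place_legs_def upt_rec)

lemmas place_legs_simps = place_legs_eval place_legs_eval[unfolded One_nat_def]

lemma par_word_simps [simp]:
  "par_word (Word [g]) = par_gen g" "par_word (u + v) = par_word u + par_word v"
  by (simp_all add: par_word_def plus_word_def)

lemma mat_units_simps [simp]:
  "mat_units [] = []" "mat_units (E i j # xs) = (i, j) # mat_units xs"
  "mat_units (One # xs) = mat_units xs" "mat_units (W w # xs) = mat_units xs"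
  by (simp_all add: mat_units_def)

lemma alg_word_simps [simp]:
  "alg_word [] = 0" "alg_word (E i j # xs) = alg_word xs"
  "alg_word (One # xs) = alg_word xs" "alg_word (W w # xs) = w + alg_word xs"
  by (simp_all add: alg_word_def)

lemma sg_add: "sg (p + r) = sg p * sg r"
  by (cases p; cases r) (simp_all add: sg_def)

lemma sg_0 [simp]: "sg 0 = 1"
  by (simp add: sg_def)

lemma sg_1 [simp]: "sg 1 = - 1"
  by (simp add: sg_def)

lemma sg_square [simp]: "sg p * sg p = 1" "sg p * (sg p * c) = c"
  by (simp_all add: sg_def)

text \<open>These leg patterns are the ones that arise from the quadratic relations, the action
  formula, \<open>J \<otimes> 1\<close> applied to the generators, and the conjugation of
  \<open>S\<close> by \<open>1 \<otimes> J\<close>.\<close>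

lemma tleg_eval:
  "tleg [E b \<alpha>, One, W u] [One, E d \<beta>, W v] =
    Poly_Mapping.single [E b \<alpha>, E d \<beta>, W (u + v)] (sg (par_word u * (par d + par \<beta>)))"
  "tleg [E b \<alpha>, E d \<beta>, W u] [E i k, E j m, One] =
    (if \<alpha> = i then if \<beta> = j then Poly_Mapping.single [E b k, E d m, W u]
       (sg ((par d + par \<beta> + par_word u) * (par i + par k) + par_word u * (par j + par m))) else 0 else 0)"
  "tleg [E i j, E a e, One] [One, E d \<beta>, W v] =
    (if e = d then Poly_Mapping.single [E i j, E a \<beta>, W v] 1 else 0)"
  "tleg [E i j, E a \<beta>, W v] [E b \<alpha>, One, W u] =
    (if j = b then Poly_Mapping.single [E i \<alpha>, E a \<beta>, W (v + u)]
       (sg ((par a + par \<beta> + par_word v) * (par b + par \<alpha>))) else 0)"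
  "tleg [E i j, One, E a e] [E c \<alpha>, W u, One] =
    (if j = c then Poly_Mapping.single [E i \<alpha>, W u, E a e]
       (sg ((par a + par e) * (par c + par \<alpha>) + (par a + par e) * par_word u)) else 0)"
  "tleg [E i j, One] [E b \<alpha>, W u] =
    (if j = b then Poly_Mapping.single [E i \<alpha>, W u] 1 else 0)"
  "tleg [One, E i j] [E a e, E c d] =
    (if j = c then Poly_Mapping.single [E a e, E i d] (sg ((par i + par j) * (par a + par e))) else 0)"
  "tleg [E a e, E i j] [One, E c d] =
    (if j = c then Poly_Mapping.single [E a e, E i d] 1 else 0)"
  by (simp_all add: tleg_def)

lemma sum_if_const: "(\<Sum>x\<in>A. if P then f x else 0) = (if P then sum f A else 0)"
  by simp

text \<open>Nested conditions show one equation per summation index, which is the shape that the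
  delta rules for sums eliminate.\<close>

lemma if_conj: "(if P \<and> Q then x else y) = (if P then if Q then x else y else y)"
  by simp

text \<open>A coefficient for every quadruple of indices replaces the sparse sums, so that
  \<open>S\<close>, its inverse, \<open>S_J\<close> and \<open>R_-\<close> all pass through the same
  entry formulas.\<close>

definition smat :: "int set \<Rightarrow> (int \<Rightarrow> int \<Rightarrow> int \<Rightarrow> int \<Rightarrow> scalar) \<Rightarrow> tens" where
  "smat A s = (\<Sum>i\<in>A. \<Sum>j\<in>A. \<Sum>a\<in>A. \<Sum>b\<in>A. Poly_Mapping.single [E i j, E a b] (s i j a b))"

definition tmat :: "int set \<Rightarrow> int set \<Rightarrow> (int \<Rightarrow> int \<Rightarrow> gen) \<Rightarrow> (int \<Rightarrow> int \<Rightarrow> scalar) \<Rightarrow> tens" where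
  "tmat A B g \<theta> = (\<Sum>\<alpha>\<in>A. \<Sum>b\<in>B. Poly_Mapping.single [E b \<alpha>, W (Word [g \<alpha> b])] (\<theta> \<alpha> b))"

lemma Tbar_eq: "Tbar l n = tmat (idx l) (idx n) Tgen (\<lambda>\<alpha> b. sg (par b * (par \<alpha> + par b)))"
  by (simp add: Tbar_def tmat_def)

lemma Tcheck_minus_eq: "Tcheck_minus l n = tmat (neg_idx l) (idx n) Pgen (\<lambda>\<alpha> b. 1)"
  by (simp add: Tcheck_minus_def tmat_def)

context
  fixes A B :: "int set" and g :: "int \<Rightarrow> int \<Rightarrow> gen" and \<theta> :: "int \<Rightarrow> int \<Rightarrow> scalar"
  assumes fin [simp]: "finite A" "finite B"
begin

text \<open>The three summands of the exponent are Koszul signs: the unit \<open>E d \<beta>\<close>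
  passes the first generator; the first leg of \<open>S\<close> passes \<open>E d \<beta>\<close>
  and both generators; the second leg of \<open>S\<close> passes both generators.\<close>

lemma entry_TTS:
  assumes "b \<in> B" "d \<in> B" "k \<in> A" "m \<in> A"
  shows "entry (place 3 [1, 3] (tmat A B g \<theta>) \<bullet>\<^sub>T place 3 [2, 3] (tmat A B g \<theta>) \<bullet>\<^sub>T
      place 3 [1, 2] (smat A s)) [(b, k), (d, m)] =
   (\<Sum>\<alpha>\<in>A. \<Sum>\<beta>\<in>A.
      Poly_Mapping.single (Word [g \<alpha> b] + Word [g \<beta> d])
        (\<theta> \<alpha> b * \<theta> \<beta> d * s \<alpha> k \<beta> m *
         sg (par_gen (g \<alpha> b) * (par d + par \<beta>) +
           (par d + par \<beta> + (par_gen (g \<alpha> b) + par_gen (g \<beta> d))) * (par \<alpha> + par k) +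
           (par_gen (g \<alpha> b) + par_gen (g \<beta> d)) * (par \<beta> + par m))))"
  by (simp add: tmat_def smat_def place_linear place_legs_simps tmult_sum tmult_single tleg_eval
    if_distrib[of "scale _"] entry_linear if_distrib[of "\<lambda>Z. entry Z _"] tmult_linear if_conj cong: if_cong)
    (simp add: assms sum_if_const sg_add ac_simps)

text \<open>\<open>entry_rels\<close> ranges over all lists of index pairs. Lists of the wrong
  length or with indices out of range must be seen to contribute only the relation
  \<open>0\<close>.\<close>

lemma entry_TTS_zero:
  assumes "\<not> (\<exists>b\<in>B. \<exists>d\<in>B. \<exists>k\<in>A. \<exists>m\<in>A. ms = [(b, k), (d, m)])"
  shows "entry (place 3 [1, 3] (tmat A B g \<theta>) \<bullet>\<^sub>T place 3 [2, 3] (tmat A B g \<theta>) \<bullet>\<^sub>T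
      place 3 [1, 2] (smat A s)) ms = 0"
  using assms
  by (simp add: tmat_def smat_def place_linear place_legs_simps tmult_sum tmult_single tleg_eval
    if_distrib[of "scale _"] entry_linear if_distrib[of "\<lambda>Z. entry Z _"] tmult_linear cong: if_cong)
    (intro sum.neutral ballI, auto)

lemma entry_STT:
  assumes "b \<in> B" "d \<in> B" "k \<in> A" "m \<in> A"
  shows "entry (place 3 [1, 2] (smat B s) \<bullet>\<^sub>T place 3 [2, 3] (tmat A B g \<theta>) \<bullet>\<^sub>T
      place 3 [1, 3] (tmat A B g \<theta>)) [(b, k), (d, m)] =
   (\<Sum>j\<in>B. \<Sum>e\<in>B.
      Poly_Mapping.single (Word [g m e] + Word [g k j])
        (s b j d e * \<theta> m e * \<theta> k j *
         sg ((par d + par m + par_gen (g m e)) * (par j + par k))))"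
  by (simp add: tmat_def smat_def place_linear place_legs_simps tmult_sum tmult_single tleg_eval
    if_distrib[of "scale _"] entry_linear if_distrib[of "\<lambda>Z. entry Z _"] tmult_linear if_conj cong: if_cong)
    (simp add: assms sum_if_const sg_add ac_simps)

lemma entry_STT_zero:
  assumes "\<not> (\<exists>b\<in>B. \<exists>d\<in>B. \<exists>k\<in>A. \<exists>m\<in>A. ms = [(b, k), (d, m)])"
  shows "entry (place 3 [1, 2] (smat B s) \<bullet>\<^sub>T place 3 [2, 3] (tmat A B g \<theta>) \<bullet>\<^sub>T
      place 3 [1, 3] (tmat A B g \<theta>)) ms = 0"
  using assms
  by (simp add: tmat_def smat_def place_linear place_legs_simps tmult_sum tmult_single tleg_eval
    if_distrib[of "scale _"] entry_linear if_distrib[of "\<lambda>Z. entry Z _"] tmult_linear cong: if_cong)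
    (intro sum.neutral ballI, auto)

end

section \<open>The coefficients of the \<open>S\<close>-matrix\<close>

lemma idx_simps [simp]:
  "finite (idx N)" "finite (neg_idx N)" "- a \<in> idx N \<longleftrightarrow> a \<in> idx N"
proof -
  show "finite (idx N)"
    by (rule finite_subset[of _ "{- int N..int N}"]) (auto simp: idx_def)
qed (auto simp: idx_def neg_idx_def)

lemma idx_nonzero: "a \<in> idx N \<Longrightarrow> a \<noteq> 0"
  by (simp add: idx_def)

lemma neg_idx_iff: "a \<in> neg_idx N \<longleftrightarrow> a \<in> idx N \<and> a < 0"
  by (auto simp: idx_def neg_idx_def)

lemma par_neg: "a < 0 \<Longrightarrow> par a = 1"
  by (simp add: par_def)

lemma par_uminus: "a \<noteq> 0 \<Longrightarrow> par (- a) = par a + 1"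
  by (simp add: par_def)

lemma sum_idx_uminus: "(\<Sum>a\<in>idx N. f (- a)) = (\<Sum>a\<in>idx N. f a)"
  by (rule sum.reindex_bij_witness[of _ uminus uminus]) simp_all

text \<open>The coefficient of \<open>E i j \<otimes> E a b\<close> in \<open>S\<close> for
  \<open>\<epsilon> = 1\<close> and in its inverse for \<open>\<epsilon> = - 1\<close>: inversion
  only changes the sign of the exponent of \<open>qq\<close> and of \<open>xi\<close>.\<close>

definition scoef :: "int \<Rightarrow> int \<Rightarrow> int \<Rightarrow> int \<Rightarrow> int \<Rightarrow> scalar" where
  "scoef \<epsilon> i j a b =
    (if i = j \<and> a = b then qq powi (\<epsilon> * phi i a) else 0) +
    (if a < b \<and> i = b \<and> j = a then of_int \<epsilon> * xi * sg (par a) else 0) +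
    (if a < b \<and> i = - b \<and> j = - a then of_int \<epsilon> * xi * sg (par a) else 0)"

lemma if_add: "(if P then x + y else 0) = (if P then x else 0) + (if P then y else (0 :: 'a :: monoid_add))"
  by simp

lemma sum_filter_pairs:
  "finite A \<Longrightarrow> (\<Sum>(i, j)\<in>{(i, j)\<in>A \<times> A. P i j}. f i j) =
    (\<Sum>i\<in>A. \<Sum>j\<in>A. if P i j then f i j else 0)"
proof -
  assume A: "finite A"
  have "{(i, j)\<in>A \<times> A. P i j} = {x \<in> A \<times> A. P (fst x) (snd x)}"
    by auto
  then show ?thesis
    using A by (simp add: sum.inter_filter sum.cartesian_product split_beta)
qed

text \<open>In both off-diagonal families of \<open>S\<close> the second leg \<open>E a b\<close>
  determines the first one: with \<open>f\<close> the identity it is \<open>E b a\<close>, with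
  \<open>f\<close> the negation it is \<open>E (- b) (- a)\<close>.\<close>

lemma sum_collapse_pairs:
  fixes f :: "int \<Rightarrow> int" and g :: "int \<Rightarrow> int \<Rightarrow> int \<Rightarrow> int \<Rightarrow> tens"
  assumes "finite A" "\<And>a. a \<in> A \<Longrightarrow> f a \<in> A"
  shows "(\<Sum>i\<in>A. \<Sum>j\<in>A. \<Sum>a\<in>A. \<Sum>b\<in>A. if a < b then if i = f b then if j = f a then g a b i j else 0 else 0 else 0)
     = (\<Sum>a\<in>A. \<Sum>b\<in>A. if a < b then g a b (f b) (f a) else 0)"
proof -
  have "(\<Sum>i\<in>A. \<Sum>j\<in>A. \<Sum>a\<in>A. \<Sum>b\<in>A. if a < b then if i = f b then if j = f a then g a b i j else 0 else 0 else 0)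
    = (\<Sum>a\<in>A. \<Sum>b\<in>A. \<Sum>i\<in>A. \<Sum>j\<in>A. if a < b then if i = f b then if j = f a then g a b i j else 0 else 0 else 0)"
    unfolding sum.cartesian_product
    by (rule sum.reindex_bij_witness[of _ "\<lambda>(a, b, i, j). (i, j, a, b)" "\<lambda>(i, j, a, b). (a, b, i, j)"]) auto
  also have "\<dots> = (\<Sum>a\<in>A. \<Sum>b\<in>A. if a < b then g a b (f b) (f a) else 0)"
    using assms by (intro sum.cong refl) (simp add: sum_if_const)
  finally show ?thesis .
qed

lemma smat_scoef:
  assumes A: "finite A" "\<And>a. a \<in> A \<Longrightarrow> - a \<in> A"
  shows "smat A (scoef \<epsilon>) =
    (\<Sum>i\<in>A. \<Sum>j\<in>A. Poly_Mapping.single [E i i, E j j] (qq powi (\<epsilon> * phi i j))) +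
    scale (of_int \<epsilon>) (\<Sum>(i, j)\<in>{(i, j)\<in>A \<times> A. i < j}.
        Poly_Mapping.single [E j i, E i j] (xi * sg (par i)) +
        Poly_Mapping.single [E (- j) (- i), E i j] (xi * sg (par i)))"
proof -
  let ?g = "\<lambda>a b i j. Poly_Mapping.single [E i j, E a b] (of_int \<epsilon> * xi * sg (par a))"
  show ?thesis
    unfolding sum_filter_pairs[OF A(1)]
    using A sum_collapse_pairs[of A "\<lambda>a. a" ?g] sum_collapse_pairs[of A uminus ?g]
    by (simp add: smat_def scoef_def single_add sum.distrib if_conj if_distrib[of "Poly_Mapping.single _"]
      sum_if_const if_add scale_add_right scale_sum if_distrib[of "scale _"] mult.assoc cong: if_cong)
qed

lemma Smat_eq: "Smat N = smat (idx N) (scoef 1)"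
  by (subst smat_scoef) (simp_all add: Smat_def)

lemma Smat_inv_eq: "Smat_inv N = smat (idx N) (scoef (- 1))"
  by (subst smat_scoef) (simp_all add: Smat_inv_def scale_minus_left)

text \<open>On negative indices the twisted term would need \<open>i = - b\<close> and cannot occur,
  \<open>phi\<close> is minus the Kronecker delta, and the odd parity of \<open>a\<close> turns
  \<open>+ xi\<close> into \<open>- xi\<close>.\<close>

lemma Rmat_minus_eq: "Rmat_minus l = smat (neg_idx l) (scoef 1)"
proof -
  have phi: "phi i j = - of_bool (i = j)" if "i \<in> neg_idx l" "j \<in> neg_idx l" for i j
    using that by (auto simp: phi_def neg_idx_def)
  have "smat (neg_idx l) (scoef 1) = smat (neg_idx l) (\<lambda>i j a b.
      (if i = j \<and> a = b then qq powi (- of_bool (i = a)) else 0) -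
      (if a < b \<and> i = b \<and> j = a then xi else 0))"
    unfolding smat_def
    by (intro sum.cong refl arg_cong[where f = "Poly_Mapping.single _"])
      (auto simp: scoef_def phi neg_idx_def par_def)
  also have "\<dots> = Rmat_minus l"
    unfolding Rmat_minus_def sum_filter_pairs[OF idx_simps(2)]
    using sum_collapse_pairs[of "neg_idx l" "\<lambda>a. a" "\<lambda>a b i j. Poly_Mapping.single [E i j, E a b] xi"]
    by (simp add: smat_def single_diff sum_subtractf if_conj if_distrib[of "Poly_Mapping.single _"]
      sum_if_const cong: if_cong)
  finally show ?thesis ..
qed

text \<open>The coordinate form of the commutation of \<open>S\<close> and its inverse with
  \<open>J \<otimes> 1\<close>: \<open>phi\<close> does not see the sign of its first argument, and
  negating \<open>i\<close> and \<open>j\<close> exchanges the two off-diagonal families.\<close>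

lemma scoef_uminus_left: "scoef \<epsilon> (- i) (- j) a b = scoef \<epsilon> i j a b"
proof -
  have "phi (- i) a = phi i a"
    by (auto simp: phi_def)
  then show ?thesis
    by (auto simp: scoef_def)
qed

text \<open>Negating \<open>a\<close> and \<open>b\<close> trades the condition \<open>a < b\<close>
  for \<open>b < a\<close> with the opposite sign and inverts the diagonal power of
  \<open>qq\<close>. The gap at \<open>a = b\<close> is filled by \<open>qq - inverse qq\<close>, so
  the correction has no order condition left: it is \<open>xi\<close> times a signed flip plus its
  \<open>J\<close>-twist, a Hecke-type relation.\<close>

lemma scoef_uminus_right:
  assumes "i \<noteq> 0" "j \<noteq> 0" "a \<noteq> 0" "b \<noteq> 0"
  shows "scoef 1 i j (- a) (- b) =
    scoef 1 i j a b - xi * sg (par a) * (of_bool (i = b \<and> j = a) + of_bool (i = - b \<and> j = - a))"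
  using assms by (auto simp: scoef_def phi_def par_def xi_def)

text \<open>\<open>S\<close> is even, so two factors need to agree only where
  \<open>|i| + |j| = |a| + |b|\<close>.\<close>

lemma scoef_par_cong:
  assumes "i \<noteq> 0" "j \<noteq> 0" "a \<noteq> 0" "b \<noteq> 0" "par i + par j = par a + par b \<Longrightarrow> x = y"
  shows "scoef \<epsilon> i j a b * x = scoef \<epsilon> i j a b * y"
proof (cases "par i + par j = par a + par b")
  case False
  then have "scoef \<epsilon> i j a b = 0"
    using assms(1-4) by (auto simp: scoef_def par_def split: if_splits)
  then show ?thesis by simp
qed (use assms in simp)

text \<open>Conjugation by \<open>J\<close> negates the indices of the second leg. The overall minus
  sign reflects that \<open>J\<close> squares to \<open>- 1\<close>, so that multiplying by
  \<open>1 \<otimes> J\<close> on both sides is minus the conjugation.\<close>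

lemma SJmat_eq: "SJmat n = smat (idx n) (\<lambda>i j a b. - scoef 1 i j (- a) (- b))"
proof -
  have "SJmat n = (\<Sum>c\<in>idx n. \<Sum>i\<in>idx n. \<Sum>j\<in>idx n. \<Sum>b\<in>idx n.
      Poly_Mapping.single [E i j, E (- c) b]
        (sg (par c) * sg (par i + par j) * scoef 1 i j c (- b) * sg (par b)))"
  proof -
    have par_J: "par (- c) + par c = 1" if "c \<in> idx n" for c
      using idx_nonzero[OF that] by (simp add: par_def)
    have "SJmat n = (\<Sum>b\<in>idx n. \<Sum>i\<in>idx n. \<Sum>j\<in>idx n. \<Sum>c\<in>idx n.
        Poly_Mapping.single [E i j, E (- c) b]
          (sg (par c) * sg (par i + par j) * scoef 1 i j c (- b) * sg (par b)))"
      by (simp add: SJmat_def Jmat_def Smat_eq smat_def place_linear place_legs_simps tmult_sum tmult_single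
        tleg_eval if_distrib[of "scale _"] tmult_linear par_J mult.commute mult.left_commute cong: if_cong)
    also have "\<dots> = (\<Sum>c\<in>idx n. \<Sum>i\<in>idx n. \<Sum>j\<in>idx n. \<Sum>b\<in>idx n.
        Poly_Mapping.single [E i j, E (- c) b]
          (sg (par c) * sg (par i + par j) * scoef 1 i j c (- b) * sg (par b)))"
      unfolding sum.cartesian_product
      by (rule sum.reindex_bij_witness[of _ "\<lambda>(c, i, j, b). (b, i, j, c)" "\<lambda>(b, i, j, c). (c, i, j, b)"]) auto
    finally show ?thesis .
  qed
  also have "\<dots> = (\<Sum>c\<in>idx n. \<Sum>i\<in>idx n. \<Sum>j\<in>idx n. \<Sum>b\<in>idx n.
      Poly_Mapping.single [E i j, E c b]
        (sg (par (- c)) * sg (par i + par j) * scoef 1 i j (- c) (- b) * sg (par b)))"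
    by (subst sum_idx_uminus[symmetric]) simp
  also have "\<dots> = (\<Sum>c\<in>idx n. \<Sum>i\<in>idx n. \<Sum>j\<in>idx n. \<Sum>b\<in>idx n.
      Poly_Mapping.single [E i j, E c b] (- scoef 1 i j (- c) (- b)))"
  proof (intro sum.cong refl arg_cong[where f = "Poly_Mapping.single _"])
    fix c i j b assume "c \<in> idx n" "i \<in> idx n" "j \<in> idx n" "b \<in> idx n"
    then have nz: "c \<noteq> 0" "i \<noteq> 0" "j \<noteq> 0" "b \<noteq> 0"
      using idx_nonzero by auto
    have "scoef 1 i j (- c) (- b) * sg (par (- c) + par i + par j + par b) = scoef 1 i j (- c) (- b) * (- 1)"
      using nz
      by (intro scoef_par_cong; cases "par i"; cases "par j"; cases "par b"; cases "par c"; simp add: par_uminus)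
    then show "sg (par (- c)) * sg (par i + par j) * scoef 1 i j (- c) (- b) * sg (par b) = - scoef 1 i j (- c) (- b)"
      by (simp add: sg_add ac_simps)
  qed
  also have "\<dots> = smat (idx n) (\<lambda>i j a b. - scoef 1 i j (- a) (- b))"
    unfolding smat_def sum.cartesian_product
    by (rule sum.reindex_bij_witness[of _ "\<lambda>(i, j, a, b). (a, i, j, b)" "\<lambda>(a, i, j, b). (i, j, a, b)"]) auto
  finally show ?thesis .
qed

section \<open>The quadratic relations\<close>

text \<open>The difference of the two sides of the defining relation at the matrix units
  \<open>(b, k)\<close> and \<open>(d, m)\<close>, with the signs of \<open>Tbar\<close> folded in.
  The generator matrix is a parameter \<open>T\<close>, so that a substitution merely replaces
  it.\<close>

definition quad_rel :: "nat \<Rightarrow> nat \<Rightarrow> (int \<Rightarrow> int \<Rightarrow> free) \<Rightarrow> int \<Rightarrow> int \<Rightarrow> int \<Rightarrow> int \<Rightarrow> free" where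
  "quad_rel l n T b k d m =
    (\<Sum>\<alpha>\<in>idx l. \<Sum>\<beta>\<in>idx l.
       scale (scoef 1 \<alpha> k \<beta> m * sg (par b + par d + par b * par \<alpha> + par d * par \<beta> +
         (par b + par k) * (par \<beta> + par d))) (T \<alpha> b * T \<beta> d)) -
    (\<Sum>j\<in>idx n. \<Sum>e\<in>idx n.
       scale (scoef 1 b j d e * sg ((par d + par e) * (par j + par k) + par e + par e * par m +
         par j + par j * par k)) (T m e * T k j))"

definition quad_rel_minus :: "nat \<Rightarrow> nat \<Rightarrow> (int \<Rightarrow> int \<Rightarrow> free) \<Rightarrow> int \<Rightarrow> int \<Rightarrow> int \<Rightarrow> int \<Rightarrow> free" where
  "quad_rel_minus l n Y b k d m =
    (\<Sum>\<alpha>\<in>neg_idx l. \<Sum>\<beta>\<in>neg_idx l.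
       scale (scoef 1 \<alpha> k \<beta> m * sg (par b * (par d + 1))) (Y \<alpha> b * Y \<beta> d)) -
    (\<Sum>j\<in>idx n. \<Sum>e\<in>idx n.
       scale (- scoef 1 b j (- d) (- e) * sg ((par d + par e + 1) * (par j + 1))) (Y m e * Y k j))"

lemma subst_quad_rel: "subst h (quad_rel l n T b k d m) = quad_rel l n (\<lambda>\<alpha> c. subst h (T \<alpha> c)) b k d m"
  by (simp add: quad_rel_def subst_linear subst_mult)

lemma subst_quad_rel_minus:
  "subst h (quad_rel_minus l n T b k d m) = quad_rel_minus l n (\<lambda>\<alpha> c. subst h (T \<alpha> c)) b k d m"
  by (simp add: quad_rel_minus_def subst_linear subst_mult)

lemma single_Word2: "Poly_Mapping.single (Word [g] + Word [g']) c = scale c (gen_elt g * gen_elt g')"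
  by (simp add: gen_elt_def mult_single)

lemma entry_A_rel:
  assumes "b \<in> idx n" "d \<in> idx n" "k \<in> idx l" "m \<in> idx l"
  shows "entry
      (place 3 [1, 3] (Tbar l n) \<bullet>\<^sub>T place 3 [2, 3] (Tbar l n) \<bullet>\<^sub>T place 3 [1, 2] (Smat l) -
       place 3 [1, 2] (Smat n) \<bullet>\<^sub>T place 3 [2, 3] (Tbar l n) \<bullet>\<^sub>T place 3 [1, 3] (Tbar l n)) [(b, k), (d, m)] =
    quad_rel l n (\<lambda>\<alpha> c. gen_elt (Tgen \<alpha> c)) b k d m"
proof -
  show ?thesis
    unfolding entry_linear Tbar_eq Smat_eq
      entry_TTS[OF idx_simps(1) idx_simps(1) assms] entry_STT[OF idx_simps(1) idx_simps(1) assms]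
      single_Word2 quad_rel_def
  proof (intro arg_cong2[where f = minus] sum.cong refl arg_cong2[where f = scale])
    fix \<alpha> \<beta> assume "\<alpha> \<in> idx l" "\<beta> \<in> idx l"
    then have nz: "\<alpha> \<noteq> 0" "\<beta> \<noteq> 0" "k \<noteq> 0" "m \<noteq> 0"
      using assms idx_nonzero by auto
    have "scoef 1 \<alpha> k \<beta> m * (sg (par b * (par \<alpha> + par b)) * sg (par d * (par \<beta> + par d)) *
         sg (par_gen (Tgen \<alpha> b) * (par d + par \<beta>) +
           (par d + par \<beta> + (par_gen (Tgen \<alpha> b) + par_gen (Tgen \<beta> d))) * (par \<alpha> + par k) +
           (par_gen (Tgen \<alpha> b) + par_gen (Tgen \<beta> d)) * (par \<beta> + par m))) =
      scoef 1 \<alpha> k \<beta> m * sg (par b + par d + par b * par \<alpha> + par d * par \<beta> +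
         (par b + par k) * (par \<beta> + par d))"
    \<comment> \<open>The two exponents differ by \<open>(|\<alpha>| + |b| + |\<beta>| + |d|)
      (|\<alpha>| + |k| + |\<beta>| + |m|)\<close>, whose second factor vanishes on the support of
      the coefficient.\<close>
    proof (rule scoef_par_cong[OF nz(1,3,2,4)])
      assume "par \<alpha> + par k = par \<beta> + par m"
      then show "sg (par b * (par \<alpha> + par b)) * sg (par d * (par \<beta> + par d)) *
          sg (par_gen (Tgen \<alpha> b) * (par d + par \<beta>) +
           (par d + par \<beta> + (par_gen (Tgen \<alpha> b) + par_gen (Tgen \<beta> d))) * (par \<alpha> + par k) +
           (par_gen (Tgen \<alpha> b) + par_gen (Tgen \<beta> d)) * (par \<beta> + par m)) =
        sg (par b + par d + par b * par \<alpha> + par d * par \<beta> + (par b + par k) * (par \<beta> + par d))"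
        by (cases "par b"; cases "par d"; cases "par \<alpha>"; cases "par \<beta>"; cases "par k"; cases "par m"; simp)
    qed
    then show "sg (par b * (par \<alpha> + par b)) * sg (par d * (par \<beta> + par d)) * scoef 1 \<alpha> k \<beta> m *
         sg (par_gen (Tgen \<alpha> b) * (par d + par \<beta>) +
           (par d + par \<beta> + (par_gen (Tgen \<alpha> b) + par_gen (Tgen \<beta> d))) * (par \<alpha> + par k) +
           (par_gen (Tgen \<alpha> b) + par_gen (Tgen \<beta> d)) * (par \<beta> + par m)) =
      scoef 1 \<alpha> k \<beta> m * sg (par b + par d + par b * par \<alpha> + par d * par \<beta> +
         (par b + par k) * (par \<beta> + par d))"
      by (simp only: ac_simps)
  next
    fix j e assume "j \<in> idx n" "e \<in> idx n"
    show "scoef 1 b j d e * sg (par e * (par m + par e)) * sg (par j * (par k + par j)) *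
       sg ((par d + par m + par_gen (Tgen m e)) * (par j + par k)) =
      scoef 1 b j d e * sg ((par d + par e) * (par j + par k) + par e + par e * par m +
         par j + par j * par k)"
      by (cases "par d"; cases "par e"; cases "par j"; cases "par k"; cases "par m"; simp)
  qed
qed

text \<open>All column indices are negative, hence odd; this is what shortens the exponents in
  \<open>quad_rel_minus\<close>.\<close>

lemma entry_APi_rel:
  assumes "b \<in> idx n" "d \<in> idx n" "k \<in> neg_idx l" "m \<in> neg_idx l"
  shows "entry
      (place 3 [1, 3] (Tcheck_minus l n) \<bullet>\<^sub>T place 3 [2, 3] (Tcheck_minus l n) \<bullet>\<^sub>T place 3 [1, 2] (Rmat_minus l) -
       place 3 [1, 2] (SJmat n) \<bullet>\<^sub>T place 3 [2, 3] (Tcheck_minus l n) \<bullet>\<^sub>T place 3 [1, 3] (Tcheck_minus l n))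
      [(b, k), (d, m)] =
    quad_rel_minus l n (\<lambda>\<alpha> c. gen_elt (Pgen \<alpha> c)) b k d m"
proof -
  have neg: "par i = 1" if "i \<in> neg_idx l" for i
    using that by (simp add: neg_idx_iff par_neg)
  show ?thesis
    unfolding entry_linear Tcheck_minus_eq Rmat_minus_eq SJmat_eq
      entry_TTS[OF idx_simps(2) idx_simps(1) assms] entry_STT[OF idx_simps(2) idx_simps(1) assms]
      single_Word2 quad_rel_minus_def
  proof (intro arg_cong2[where f = minus] sum.cong refl arg_cong2[where f = scale], goal_cases)
    case (1 \<alpha> \<beta>)
    then show ?case
      using assms(3,4) by (cases "par b"; cases "par d"; simp add: neg)
  next
    case (2 j e)
    then show ?case
      using assms(3,4) by (cases "par d"; cases "par e"; cases "par j"; simp add: neg)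
  qed
qed

text \<open>The symmetry \<open>(J \<otimes> 1)S = S(J \<otimes> 1)\<close> reduces the relations to \<open>k < 0\<close>, and
  \<open>S - (1 \<otimes> J)S(1 \<otimes> J\<inverse>)\<close> being a multiple of a twisted flip reduces them to \<open>m < 0\<close>.\<close>

context
  fixes l n :: nat and T :: "int \<Rightarrow> int \<Rightarrow> free" and b k d m :: int
  assumes sym: "\<And>\<alpha> c. \<alpha> \<in> idx l \<Longrightarrow> c \<in> idx n \<Longrightarrow> T (- \<alpha>) (- c) = scale (sg (par \<alpha> + par c)) (T \<alpha> c)"
    and mem: "b \<in> idx n" "d \<in> idx n" "k \<in> idx l" "m \<in> idx l"
begin

lemma mem_nonzero: "b \<noteq> 0" "d \<noteq> 0" "k \<noteq> 0" "m \<noteq> 0"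
  using mem idx_nonzero by auto

lemma quad_rel_uminus_left: "quad_rel l n T (- b) (- k) d m = quad_rel l n T b k d m"
proof -
  have "(\<Sum>\<alpha>\<in>idx l. \<Sum>\<beta>\<in>idx l.
       scale (scoef 1 \<alpha> (- k) \<beta> m * sg (par (- b) + par d + par (- b) * par \<alpha> + par d * par \<beta> +
         (par (- b) + par (- k)) * (par \<beta> + par d))) (T \<alpha> (- b) * T \<beta> d)) =
    (\<Sum>\<alpha>\<in>idx l. \<Sum>\<beta>\<in>idx l.
       scale (scoef 1 \<alpha> k \<beta> m * sg (par b + par d + par b * par \<alpha> + par d * par \<beta> +
         (par b + par k) * (par \<beta> + par d))) (T \<alpha> b * T \<beta> d))"
  \<comment> \<open>After reindexing by negation, \<open>sym\<close> applies to the factor with row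
    \<open>- b\<close> and \<open>scoef_uminus_left\<close> to the coefficient.\<close>
  proof (rule trans[OF sum_idx_uminus[symmetric]], rule sum.cong[OF refl], rule sum.cong[OF refl])
    fix \<alpha> \<beta> assume \<alpha>: "\<alpha> \<in> idx l" and \<beta>: "\<beta> \<in> idx l"
    have "sg (par (- b) + par d + par (- b) * par (- \<alpha>) + par d * par \<beta> +
         (par (- b) + par (- k)) * (par \<beta> + par d)) * sg (par \<alpha> + par b) =
      sg (par b + par d + par b * par \<alpha> + par d * par \<beta> + (par b + par k) * (par \<beta> + par d))"
      using mem_nonzero idx_nonzero[OF \<alpha>]
      by (cases "par b"; cases "par d"; cases "par \<alpha>"; cases "par \<beta>"; cases "par k"; simp add: par_uminus)
    then show "scale (scoef 1 (- \<alpha>) (- k) \<beta> m * sg (par (- b) + par d + par (- b) * par (- \<alpha>) + par d * par \<beta> +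
         (par (- b) + par (- k)) * (par \<beta> + par d))) (T (- \<alpha>) (- b) * T \<beta> d) =
      scale (scoef 1 \<alpha> k \<beta> m * sg (par b + par d + par b * par \<alpha> + par d * par \<beta> +
         (par b + par k) * (par \<beta> + par d))) (T \<alpha> b * T \<beta> d)"
      by (simp add: sym[OF \<alpha> mem(1)] scale_mult_left scoef_uminus_left mult.assoc)
  qed
  moreover have "(\<Sum>j\<in>idx n. \<Sum>e\<in>idx n.
       scale (scoef 1 (- b) j d e * sg ((par d + par e) * (par j + par (- k)) + par e + par e * par m +
         par j + par j * par (- k))) (T m e * T (- k) j)) =
    (\<Sum>j\<in>idx n. \<Sum>e\<in>idx n.
       scale (scoef 1 b j d e * sg ((par d + par e) * (par j + par k) + par e + par e * par m +
         par j + par j * par k)) (T m e * T k j))"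
  proof (rule trans[OF sum_idx_uminus[symmetric]], rule sum.cong[OF refl], rule sum.cong[OF refl])
    fix j e assume j: "j \<in> idx n" and e: "e \<in> idx n"
    have "sg ((par d + par e) * (par (- j) + par (- k)) + par e + par e * par m +
         par (- j) + par (- j) * par (- k)) * sg (par k + par j) =
      sg ((par d + par e) * (par j + par k) + par e + par e * par m + par j + par j * par k)"
      using mem_nonzero idx_nonzero[OF j]
      by (cases "par e"; cases "par d"; cases "par j"; cases "par m"; cases "par k"; simp add: par_uminus)
    then show "scale (scoef 1 (- b) (- j) d e * sg ((par d + par e) * (par (- j) + par (- k)) + par e + par e * par m +
         par (- j) + par (- j) * par (- k))) (T m e * T (- k) (- j)) =
      scale (scoef 1 b j d e * sg ((par d + par e) * (par j + par k) + par e + par e * par m +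
         par j + par j * par k)) (T m e * T k j)"
      by (simp add: sym[OF mem(3) j] mult_scale_right scoef_uminus_left mult.assoc)
  qed
  ultimately show ?thesis
    by (simp add: quad_rel_def)
qed

lemma quad_rel_uminus_right: "quad_rel l n T b k (- d) (- m) = quad_rel l n T b k d m"
proof -
  define s where "s \<alpha> \<beta> = sg (par b + par d + par b * par \<alpha> + par d * par \<beta> +
         (par b + par k) * (par \<beta> + par d))" for \<alpha> \<beta>
  define t where "t j e = sg ((par d + par e) * (par j + par k) + par e + par e * par m +
         par j + par j * par k)" for j e
  \<comment> \<open>\<open>E1\<close> and \<open>E2\<close> are the flip corrections of
    \<open>scoef_uminus_right\<close> on the two sides. Each side loses its own, so the relation is
    unchanged as soon as they coincide.\<close>
  define E1 where "E1 = (\<Sum>\<alpha>\<in>idx l. \<Sum>\<beta>\<in>idx l. scale (xi * sg (par \<beta>) *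
    (of_bool (\<alpha> = m \<and> k = \<beta>) + of_bool (\<alpha> = - m \<and> k = - \<beta>)) * s \<alpha> \<beta>) (T \<alpha> b * T \<beta> d))"
  define E2 where "E2 = (\<Sum>j\<in>idx n. \<Sum>e\<in>idx n. scale (xi * sg (par d) *
    (of_bool (b = e \<and> j = d) + of_bool (b = - e \<and> j = - d)) * t j e) (T m e * T k j))"
  have "(\<Sum>\<alpha>\<in>idx l. \<Sum>\<beta>\<in>idx l.
       scale (scoef 1 \<alpha> k \<beta> (- m) * sg (par b + par (- d) + par b * par \<alpha> + par (- d) * par \<beta> +
         (par b + par k) * (par \<beta> + par (- d)))) (T \<alpha> b * T \<beta> (- d))) =
    (\<Sum>\<alpha>\<in>idx l. \<Sum>\<beta>\<in>idx l. scale (scoef 1 \<alpha> k \<beta> m * s \<alpha> \<beta>) (T \<alpha> b * T \<beta> d)) - E1"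
    unfolding E1_def sum_subtractf[symmetric]
  proof (rule sum.cong[OF refl], rule trans[OF sum_idx_uminus[symmetric]], rule sum.cong[OF refl])
    fix \<alpha> \<beta> assume \<alpha>: "\<alpha> \<in> idx l" and \<beta>: "\<beta> \<in> idx l"
    note nz = idx_nonzero[OF \<alpha>] idx_nonzero[OF \<beta>] mem_nonzero
    have "sg (par b + par (- d) + par b * par \<alpha> + par (- d) * par (- \<beta>) +
         (par b + par k) * (par (- \<beta>) + par (- d))) * sg (par \<beta> + par d) = s \<alpha> \<beta>"
      using nz unfolding s_def
      by (cases "par b"; cases "par d"; cases "par \<alpha>"; cases "par \<beta>"; cases "par k"; simp add: par_uminus)
    then have "scale (scoef 1 \<alpha> k (- \<beta>) (- m) * sg (par b + par (- d) + par b * par \<alpha> + par (- d) * par (- \<beta>) +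
         (par b + par k) * (par (- \<beta>) + par (- d)))) (T \<alpha> b * T (- \<beta>) (- d)) =
      scale (scoef 1 \<alpha> k (- \<beta>) (- m) * s \<alpha> \<beta>) (T \<alpha> b * T \<beta> d)"
      by (simp add: sym[OF \<beta> mem(2)] mult_scale_right mult.assoc)
    moreover have "scoef 1 \<alpha> k (- \<beta>) (- m) = scoef 1 \<alpha> k \<beta> m -
        xi * sg (par \<beta>) * (of_bool (\<alpha> = m \<and> k = \<beta>) + of_bool (\<alpha> = - m \<and> k = - \<beta>))"
      using nz by (simp add: scoef_uminus_right)
    ultimately show "scale (scoef 1 \<alpha> k (- \<beta>) (- m) * sg (par b + par (- d) + par b * par \<alpha> + par (- d) * par (- \<beta>) +
         (par b + par k) * (par (- \<beta>) + par (- d)))) (T \<alpha> b * T (- \<beta>) (- d)) =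
      scale (scoef 1 \<alpha> k \<beta> m * s \<alpha> \<beta>) (T \<alpha> b * T \<beta> d) -
      scale (xi * sg (par \<beta>) * (of_bool (\<alpha> = m \<and> k = \<beta>) + of_bool (\<alpha> = - m \<and> k = - \<beta>)) * s \<alpha> \<beta>)
        (T \<alpha> b * T \<beta> d)"
      by (simp only: left_diff_distrib scale_diff_left)
  qed
  moreover have "(\<Sum>j\<in>idx n. \<Sum>e\<in>idx n.
       scale (scoef 1 b j (- d) e * sg ((par (- d) + par e) * (par j + par k) + par e + par e * par (- m) +
         par j + par j * par k)) (T (- m) e * T k j)) =
    (\<Sum>j\<in>idx n. \<Sum>e\<in>idx n. scale (scoef 1 b j d e * t j e) (T m e * T k j)) - E2"
    unfolding E2_def sum_subtractf[symmetric]
  proof (rule sum.cong[OF refl], rule trans[OF sum_idx_uminus[symmetric]], rule sum.cong[OF refl])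
    fix j e assume j: "j \<in> idx n" and e: "e \<in> idx n"
    note nz = idx_nonzero[OF j] idx_nonzero[OF e] mem_nonzero
    have "sg ((par (- d) + par (- e)) * (par j + par k) + par (- e) + par (- e) * par (- m) +
         par j + par j * par k) * sg (par m + par e) = t j e"
      using nz unfolding t_def
      by (cases "par e"; cases "par d"; cases "par j"; cases "par m"; cases "par k"; simp add: par_uminus)
    then have "scale (scoef 1 b j (- d) (- e) * sg ((par (- d) + par (- e)) * (par j + par k) + par (- e) + par (- e) * par (- m) +
         par j + par j * par k)) (T (- m) (- e) * T k j) =
      scale (scoef 1 b j (- d) (- e) * t j e) (T m e * T k j)"
      by (simp add: sym[OF mem(4) e] scale_mult_left mult.assoc)
    moreover have "scoef 1 b j (- d) (- e) = scoef 1 b j d e -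
        xi * sg (par d) * (of_bool (b = e \<and> j = d) + of_bool (b = - e \<and> j = - d))"
      using nz by (simp add: scoef_uminus_right)
    ultimately show "scale (scoef 1 b j (- d) (- e) * sg ((par (- d) + par (- e)) * (par j + par k) + par (- e) + par (- e) * par (- m) +
         par j + par j * par k)) (T (- m) (- e) * T k j) =
      scale (scoef 1 b j d e * t j e) (T m e * T k j) -
      scale (xi * sg (par d) * (of_bool (b = e \<and> j = d) + of_bool (b = - e \<and> j = - d)) * t j e)
        (T m e * T k j)"
      by (simp only: left_diff_distrib scale_diff_left)
  qed
  \<comment> \<open>Each correction is supported at two index pairs. The untwisted terms are both
    multiples of \<open>T m b * T k d\<close>. The twisted term of \<open>E1\<close> involves
    \<open>T (- m) b * T (- k) d\<close>, which \<open>sym\<close> turns into the product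
    \<open>T m (- b) * T k (- d)\<close> of \<open>E2\<close>.\<close>
  moreover have "E1 = E2"
  proof -
    have collapse: "(\<Sum>x\<in>A. \<Sum>y\<in>A. scale (of_bool (x = u \<and> y = v) * c x y) (F x y)) = scale (c u v) (F u v)"
      if "finite A" "u \<in> A" "v \<in> A" for A :: "int set" and u v c and F :: "int \<Rightarrow> int \<Rightarrow> free"
    proof -
      have "(\<Sum>x\<in>A. \<Sum>y\<in>A. scale (of_bool (x = u \<and> y = v) * c x y) (F x y)) =
        (\<Sum>x\<in>A. \<Sum>y\<in>A. if x = u then if y = v then scale (c x y) (F x y) else 0 else 0)"
        by (intro sum.cong refl) simp
      then show ?thesis
        using that by (simp add: sum_if_const)
    qed
    have "E1 = (\<Sum>\<alpha>\<in>idx l. \<Sum>\<beta>\<in>idx l. scale (of_bool (\<alpha> = m \<and> \<beta> = k) * (xi * sg (par \<beta>) * s \<alpha> \<beta>)) (T \<alpha> b * T \<beta> d)) +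
      (\<Sum>\<alpha>\<in>idx l. \<Sum>\<beta>\<in>idx l. scale (of_bool (\<alpha> = - m \<and> \<beta> = - k) * (xi * sg (par \<beta>) * s \<alpha> \<beta>)) (T \<alpha> b * T \<beta> d))"
      unfolding E1_def sum.distrib[symmetric] scale_add_left[symmetric]
      by (intro sum.cong refl arg_cong2[where f = scale]) auto
    also have "\<dots> = scale (xi * sg (par k) * s m k) (T m b * T k d) +
        scale (xi * sg (par (- k)) * s (- m) (- k)) (T (- m) b * T (- k) d)"
      using mem by (simp only: collapse idx_simps)
    also have "T (- m) b = scale (sg (par m + par (- b))) (T m (- b))"
      using sym[of m "- b"] mem by simp
    also have "T (- k) d = scale (sg (par k + par (- d))) (T k (- d))"
      using sym[of k "- d"] mem by simp
    also have "scale (xi * sg (par k) * s m k) (T m b * T k d) +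
        scale (xi * sg (par (- k)) * s (- m) (- k))
          (scale (sg (par m + par (- b))) (T m (- b)) * scale (sg (par k + par (- d))) (T k (- d))) =
      scale (xi * sg (par d) * t d b) (T m b * T k d) +
        scale (xi * sg (par d) * t (- d) (- b)) (T m (- b) * T k (- d))"
    proof -
      have "sg (par k) * s m k = sg (par d) * t d b"
        unfolding s_def t_def by (cases "par b"; cases "par d"; cases "par k"; cases "par m"; simp)
      moreover have "sg (par (- k)) * s (- m) (- k) * (sg (par k + par (- d)) * sg (par m + par (- b))) =
          sg (par d) * t (- d) (- b)"
        unfolding s_def t_def using mem_nonzero
        by (cases "par b"; cases "par d"; cases "par k"; cases "par m"; simp add: par_uminus)
      ultimately show ?thesis
        by (simp add: scale_mult_left mult_scale_right mult.assoc)
    qed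
    also have "\<dots> = (\<Sum>j\<in>idx n. \<Sum>e\<in>idx n. scale (of_bool (j = d \<and> e = b) * (xi * sg (par d) * t j e)) (T m e * T k j)) +
      (\<Sum>j\<in>idx n. \<Sum>e\<in>idx n. scale (of_bool (j = - d \<and> e = - b) * (xi * sg (par d) * t j e)) (T m e * T k j))"
      using mem by (simp only: collapse idx_simps)
    also have "\<dots> = E2"
      unfolding E2_def sum.distrib[symmetric] scale_add_left[symmetric]
      by (intro sum.cong refl arg_cong2[where f = scale]) auto
    finally show ?thesis .
  qed
  ultimately show ?thesis
    by (simp add: quad_rel_def s_def t_def)
qed

end

text \<open>Write \<open>J1\<close>, \<open>J2\<close> for \<open>J\<close> in the two matrix
  positions and suppose \<open>Y = J T\<close>. Then \<open>Y13 Y23 = J1 J2 T13 T23\<close>, while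
  \<open>Y23 Y13 = J2 J1 T23 T13 = - J1 J2 T23 T13\<close>. Moving \<open>J1 J2\<close> through
  \<open>S\<close> conjugates it by \<open>J2\<close> alone, as \<open>J1\<close> commutes with
  \<open>S\<close>; the minus sign from reordering cancels the one in
  \<open>J2\<inverse> = - J2\<close>, which leaves exactly \<open>S_J\<close>. The identity serves
  both directions: either \<open>T\<close> consists of generators and \<open>Y\<close> of their
  images under the isomorphism, or \<open>Y\<close> consists of generators and \<open>T\<close> of
  images under the inverse.\<close>

lemma quad_rel_minus_eq:
  assumes T: "\<And>\<alpha> c. \<alpha> \<in> neg_idx l \<Longrightarrow> c \<in> idx n \<Longrightarrow> T \<alpha> c = scale (sg (par c)) (Y \<alpha> (- c))"
    and mem: "b \<in> idx n" "d \<in> idx n" "k \<in> neg_idx l" "m \<in> neg_idx l"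
  shows "quad_rel_minus l n Y b k d m = scale (sg (par d)) (quad_rel l n T (- b) k (- d) m)"
proof -
  have nz: "b \<noteq> 0" "d \<noteq> 0"
    using mem idx_nonzero by auto
  have neg: "par i = 1" if "i \<in> neg_idx l" for i
    using that by (simp add: neg_idx_iff par_neg)
  have Y: "Y \<alpha> (- c) = scale (sg (par c)) (T \<alpha> c)" if "\<alpha> \<in> neg_idx l" "c \<in> idx n" for \<alpha> c
    using T[OF that] by simp
  have Y': "Y \<alpha> c = scale (sg (par (- c))) (T \<alpha> (- c))" if "\<alpha> \<in> neg_idx l" "c \<in> idx n" for \<alpha> c
    using Y[of \<alpha> "- c"] that by simp
  have "(\<Sum>\<alpha>\<in>neg_idx l. \<Sum>\<beta>\<in>neg_idx l.
       scale (scoef 1 \<alpha> k \<beta> m * sg (par b * (par d + 1))) (Y \<alpha> b * Y \<beta> d)) =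
    (\<Sum>\<alpha>\<in>neg_idx l. \<Sum>\<beta>\<in>neg_idx l.
       scale (sg (par d) * (scoef 1 \<alpha> k \<beta> m * sg (par (- b) + par (- d) + par (- b) * par \<alpha> + par (- d) * par \<beta> +
         (par (- b) + par k) * (par \<beta> + par (- d))))) (T \<alpha> (- b) * T \<beta> (- d)))"
  proof (intro sum.cong refl)
    fix \<alpha> \<beta> assume \<alpha>: "\<alpha> \<in> neg_idx l" and \<beta>: "\<beta> \<in> neg_idx l"
    have "sg (par b * (par d + 1)) * (sg (par (- d)) * sg (par (- b))) =
      sg (par d) * sg (par (- b) + par (- d) + par (- b) * par \<alpha> + par (- d) * par \<beta> +
         (par (- b) + par k) * (par \<beta> + par (- d)))"
      unfolding neg[OF \<alpha>] neg[OF \<beta>] neg[OF mem(3)]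
      using nz by (cases "par b"; cases "par d"; simp add: par_uminus)
    then show "scale (scoef 1 \<alpha> k \<beta> m * sg (par b * (par d + 1))) (Y \<alpha> b * Y \<beta> d) =
      scale (sg (par d) * (scoef 1 \<alpha> k \<beta> m * sg (par (- b) + par (- d) + par (- b) * par \<alpha> + par (- d) * par \<beta> +
         (par (- b) + par k) * (par \<beta> + par (- d))))) (T \<alpha> (- b) * T \<beta> (- d))"
      by (simp add: Y'[OF \<alpha> mem(1)] Y'[OF \<beta> mem(2)] scale_mult_left mult_scale_right mult.assoc
        mult.left_commute[of "sg (par d)"])
  qed
  also have "\<dots> = (\<Sum>\<alpha>\<in>idx l. \<Sum>\<beta>\<in>idx l.
       scale (sg (par d) * (scoef 1 \<alpha> k \<beta> m * sg (par (- b) + par (- d) + par (- b) * par \<alpha> + par (- d) * par \<beta> +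
         (par (- b) + par k) * (par \<beta> + par (- d))))) (T \<alpha> (- b) * T \<beta> (- d)))"
  proof -
    \<comment> \<open>For negative columns \<open>S\<close> has only negative rows: the twisted term
      would require \<open>\<beta> = - k > 0\<close> together with \<open>\<beta> < m < 0\<close>.
      This is why \<open>R_-\<close> may stand in for \<open>S\<close> here.\<close>
    have zero: "scoef 1 \<alpha> k \<beta> m = 0"
      if "(\<alpha>, \<beta>) \<in> idx l \<times> idx l - neg_idx l \<times> neg_idx l" for \<alpha> \<beta>
      using that mem(3,4) by (auto simp: neg_idx_iff scoef_def dest: idx_nonzero)
    show ?thesis
      unfolding sum.cartesian_product
    proof (rule sum.mono_neutral_left, goal_cases)
      case 3
      show ?case
      proof
        fix x assume "x \<in> idx l \<times> idx l - neg_idx l \<times> neg_idx l"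
        then obtain \<alpha> \<beta> where "x = (\<alpha>, \<beta>)" "scoef 1 \<alpha> k \<beta> m = 0"
          using zero by (cases x) blast
        then show "(case x of (\<alpha>, \<beta>) \<Rightarrow> scale (sg (par d) * (scoef 1 \<alpha> k \<beta> m *
            sg (par (- b) + par (- d) + par (- b) * par \<alpha> + par (- d) * par \<beta> +
              (par (- b) + par k) * (par \<beta> + par (- d))))) (T \<alpha> (- b) * T \<beta> (- d))) = 0"
          by simp
      qed
    qed (auto simp: neg_idx_iff)
  qed
  moreover have "(\<Sum>j\<in>idx n. \<Sum>e\<in>idx n.
       scale (- scoef 1 b j (- d) (- e) * sg ((par d + par e + 1) * (par j + 1))) (Y m e * Y k j)) =
    (\<Sum>j\<in>idx n. \<Sum>e\<in>idx n.
       scale (sg (par d) * (scoef 1 (- b) j (- d) e * sg ((par (- d) + par e) * (par j + par k) + par e + par e * par m +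
         par j + par j * par k))) (T m e * T k j))"
  \<comment> \<open>Both summation indices are negated: \<open>e\<close> to undo the sign inside
    \<open>S_J\<close>, and \<open>j\<close> so that \<open>scoef_uminus_left\<close> moves the sign
    onto \<open>b\<close>.\<close>
  proof (rule trans[OF sum_idx_uminus[symmetric]], rule sum.cong[OF refl], rule trans[OF sum_idx_uminus[symmetric]], rule sum.cong[OF refl])
    fix j e assume j: "j \<in> idx n" and e: "e \<in> idx n"
    have "- (sg ((par d + par (- e) + 1) * (par (- j) + 1)) * (sg (par j) * sg (par e))) =
      sg (par d) * sg ((par (- d) + par e) * (par j + par k) + par e + par e * par m + par j + par j * par k)"
      unfolding neg[OF mem(3)] neg[OF mem(4)]
      using nz idx_nonzero[OF j] idx_nonzero[OF e]
      by (cases "par e"; cases "par d"; cases "par j"; simp add: par_uminus)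
    then have "scoef 1 b (- j) (- d) e * - (sg ((par d + par (- e) + 1) * (par (- j) + 1)) * (sg (par j) * sg (par e))) =
      scoef 1 (- b) j (- d) e * (sg (par d) * sg ((par (- d) + par e) * (par j + par k) + par e + par e * par m + par j + par j * par k))"
      using scoef_uminus_left[of 1 b "- j" "- d" e] by simp
    then show "scale (- scoef 1 b (- j) (- d) (- (- e)) * sg ((par d + par (- e) + 1) * (par (- j) + 1))) (Y m (- e) * Y k (- j)) =
      scale (sg (par d) * (scoef 1 (- b) j (- d) e * sg ((par (- d) + par e) * (par j + par k) + par e + par e * par m +
         par j + par j * par k))) (T m e * T k j)"
      by (simp add: Y[OF mem(4) e] Y[OF mem(3) j] scale_mult_left mult_scale_right mult.assoc
        mult.left_commute[of "sg (par d)"])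
  qed
  ultimately show ?thesis
    by (simp add: quad_rel_minus_def quad_rel_def scale_diff_right scale_sum)
qed

section \<open>The generators occurring in a tensor\<close>

fun leg_in :: "gen set \<Rightarrow> leg \<Rightarrow> bool" where
  "leg_in G (W w) \<longleftrightarrow> set (letters w) \<subseteq> G"
| "leg_in G _ \<longleftrightarrow> True"

text \<open>Needed twice: the entries of the matrix equations must lie in the free algebra on the
  intended generators before they can generate an ideal there, and the terms of the coproduct must
  be pairs of words in the \<open>L\<close>-generators.\<close>

definition tens_in :: "gen set \<Rightarrow> nat \<Rightarrow> tens \<Rightarrow> bool" where
  "tens_in G k Z \<longleftrightarrow> (\<forall>x\<in>Poly_Mapping.keys Z. length x = k \<and> list_all (leg_in G) x)"

lemma tens_in_single: "length x = k \<Longrightarrow> list_all (leg_in G) x \<Longrightarrow> tens_in G k (Poly_Mapping.single x c)"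
  by (simp add: tens_in_def)

lemma tens_in_zero: "tens_in G k 0"
  by (simp add: tens_in_def)

lemma tens_in_add: "tens_in G k Z \<Longrightarrow> tens_in G k Y \<Longrightarrow> tens_in G k (Z + Y)"
  unfolding tens_in_def using keys_add[of Z Y] by blast

lemma tens_in_scale: "tens_in G k Z \<Longrightarrow> tens_in G k (scale c Z)"
  unfolding tens_in_def using keys_scale[of c Z] by blast

lemma tens_in_diff: "tens_in G k Z \<Longrightarrow> tens_in G k Y \<Longrightarrow> tens_in G k (Z - Y)"
  using tens_in_add[of G k Z "scale (- 1) Y"] tens_in_scale[of G k Y "- 1"]
  by (simp add: scale_minus_left)

lemma tens_in_sum: "(\<And>x. x \<in> A \<Longrightarrow> tens_in G k (f x)) \<Longrightarrow> tens_in G k (sum f A)"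
  by (induction A rule: infinite_finite_induct) (auto simp: tens_in_zero tens_in_add)

lemma leg_mult_in: "leg_mult x y = Some z \<Longrightarrow> leg_in G x \<Longrightarrow> leg_in G y \<Longrightarrow> leg_in G z"
  by (cases x; cases y) (auto simp: plus_word_def split: if_splits)

lemma legs_mult_in:
  "those (map2 leg_mult x y) = Some z \<Longrightarrow> list_all (leg_in G) x \<Longrightarrow> list_all (leg_in G) y \<Longrightarrow>
    length z = min (length x) (length y) \<and> list_all (leg_in G) z"
proof (induction x y arbitrary: z rule: list_induct2')
  case (4 a x b y)
  then show ?case
    by (auto split: option.splits dest: leg_mult_in)
qed auto

lemma tens_in_tmult:
  assumes "tens_in G k Z" "tens_in G k Y"
  shows "tens_in G k (Z \<bullet>\<^sub>T Y)"
  unfolding tens_in_def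
proof
  fix z assume "z \<in> Poly_Mapping.keys (Z \<bullet>\<^sub>T Y)"
  then obtain x y where xy: "x \<in> Poly_Mapping.keys Z" "y \<in> Poly_Mapping.keys Y"
    and "z \<in> Poly_Mapping.keys (tleg x y)"
    using keys_lin[of "\<lambda>x. lin (tleg x) Y" Z] keys_lin[of "tleg _" Y] unfolding tmult_eq_lin by blast
  then have "those (map2 leg_mult x y) = Some z"
    by (auto simp: tleg_def split: option.splits if_splits)
  with xy assms show "length z = k \<and> list_all (leg_in G) z"
    unfolding tens_in_def by (metis legs_mult_in min.idem)
qed

lemma tens_in_place:
  assumes "tens_in G j Z"
  shows "tens_in G k (place k ps Z)"
  unfolding tens_in_def
proof
  fix z assume "z \<in> Poly_Mapping.keys (place k ps Z)"
  then obtain x where x: "x \<in> Poly_Mapping.keys Z" and z: "z = place_legs k ps x"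
    unfolding place_eq_lin using keys_lin[of "\<lambda>x. Poly_Mapping.single (place_legs k ps x) 1" Z] by auto
  have "list_all (leg_in G) x"
    using x assms by (simp add: tens_in_def)
  then have "leg_in G (case map_of (zip ps x) i of None \<Rightarrow> One | Some v \<Rightarrow> v)" for i
    by (auto split: option.split simp: list_all_iff dest!: map_of_SomeD set_zip_rightD)
  then show "length z = k \<and> list_all (leg_in G) z"
    by (simp add: z place_legs_def list_all_iff)
qed

lemma entry_closed:
  assumes "tens_in G k Z"
  shows "entry Z ms \<in> carrier (free_alg G)"
proof -
  have "set (letters (alg_word x)) \<subseteq> G" if "list_all (leg_in G) x" for x
    using that
  proof (induction x)
    case Nil
    then show ?case by (simp add: zero_word_def)
  next
    case (Cons a x)
    then show ?case by (cases a) (auto simp: plus_word_def)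
  qed
  then show ?thesis
    using assms keys_lin[of "\<lambda>x. if mat_units x = ms then Poly_Mapping.single (alg_word x) (1 :: scalar) else 0" Z]
    unfolding entry_eq_lin free_alg_carrier tens_in_def by (fastforce split: if_splits)
qed

lemma tens_in_smat: "tens_in G 2 (smat A s)"
  by (auto simp: smat_def intro!: tens_in_sum tens_in_single)

lemma tens_in_tmat:
  "(\<And>\<alpha> b. \<alpha> \<in> A \<Longrightarrow> b \<in> B \<Longrightarrow> g \<alpha> b \<in> G) \<Longrightarrow> tens_in G 2 (tmat A B g \<theta>)"
  by (auto simp: tmat_def intro!: tens_in_sum tens_in_single)

lemmas tens_in_intros = tens_in_diff tens_in_tmult tens_in_place tens_in_smat tens_in_tmat

lemma tens_in_Lmat: "tens_in (U_gens n) 2 (Lmat n)"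
  by (auto simp: Lmat_def U_gens_def intro!: tens_in_sum tens_in_single)

lemma U_rels_closed: "U_rels n \<subseteq> carrier (free_alg (U_gens n))"
proof -
  have "gen_elt (Lgen i i) \<in> carrier (free_alg (U_gens n))" if "i \<in> idx n" for i
    using that by (intro free_alg_closed) (auto simp: U_gens_def)
  then show ?thesis
    unfolding U_rels_def entry_rels_def Smat_eq
    by (auto intro!: free_alg_diff_closed free_alg_mult_closed free_alg_closed(2) entry_closed[where k = 3]
        tens_in_intros tens_in_Lmat)
qed

lemma A_rels_closed: "A_rels l n \<subseteq> carrier (free_alg (A_gens l n))"
proof -
  have "gen_elt (Tgen i j) \<in> carrier (free_alg (A_gens l n))" if "i \<in> idx l" "j \<in> idx n" for i j
    using that by (intro free_alg_closed) (auto simp: A_gens_def)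
  then show ?thesis
    unfolding A_rels_def entry_rels_def Smat_eq Tbar_eq
    by (auto intro!: free_alg_diff_closed free_alg_scale_closed entry_closed[where k = 3] tens_in_intros
        simp: A_gens_def)
qed

lemma APi_rels_closed: "APi_rels l n \<subseteq> carrier (free_alg (APi_gens l n))"
  unfolding APi_rels_def entry_rels_def Rmat_minus_eq SJmat_eq Tcheck_minus_eq
  by (auto intro!: entry_closed[where k = 3] tens_in_intros simp: APi_gens_def)

lemma coprod_tens_in:
  assumes "f \<in> carrier (free_alg (U_gens n))"
  shows "tens_in (U_gens n) 2 (coprod f)"
proof -
  have gen: "tens_in (U_gens n) 2 (coprod_gen g)" if "g \<in> U_gens n" for g
    using that by (auto simp: U_gens_def idx_def abs_le_iff intro!: tens_in_sum tens_in_single)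
  have "tens_in (U_gens n) 2 (foldr (\<lambda>g Z. coprod_gen g \<bullet>\<^sub>T Z) u (Poly_Mapping.single [W 0, W 0] 1))"
    if "set u \<subseteq> U_gens n" for u
    using that by (induction u) (auto simp: zero_word_def intro!: tens_in_tmult gen tens_in_single)
  then show ?thesis
    using assms by (auto simp: coprod_def coprod_word_def free_alg_carrier intro!: tens_in_sum tens_in_scale)
qed

section \<open>Homomorphisms of presented superalgebras\<close>

lemma subst_subst: "subst k (subst h f) = subst (\<lambda>g. subst k (h g)) f"
proof -
  have "subst k (prod_list (map h u)) = prod_list (map (\<lambda>g. subst k (h g)) u)" for u
    by (induction u) (simp_all add: subst_mult)
  moreover have "subst k (lin H f) = lin (\<lambda>x. subst k (H x)) f" for H
    by (simp add: lin_def subst_linear)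
  ultimately show ?thesis
    by (simp add: subst_def[of h] subst_def[of "\<lambda>g. subst k (h g)"])
qed

text \<open>Letters are replaced one at a time: with \<open>H\<close> the image of the remaining
  word \<open>w\<close>, the difference \<open>h g * H - g * w\<close> equals
  \<open>(h g - g) * H + g * (H - w)\<close>, and the ideal is two-sided.\<close>

lemma (in presentation) subst_congruent:
  assumes f: "f \<in> carrier FF"
    and h: "\<And>g. g \<in> G \<Longrightarrow> h g \<in> carrier FF" "\<And>g. g \<in> G \<Longrightarrow> h g - gen_elt g \<in> II"
  shows "subst h f - f \<in> II"
  using f
proof (induction rule: free_alg_induct)
  case (single w c)
  have prod_list: "prod_list (map h u) \<in> carrier FF \<and> prod_list (map h u) - Poly_Mapping.single (Word u) 1 \<in> II"
    if "set u \<subseteq> G" for u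
    using that
  proof (induction u)
    case Nil
    then show ?case
      using free_alg_closed(2)[of G] by (simp add: ideal_zero flip: zero_word_def)
  next
    case (Cons g u)
    then have "(h g - gen_elt g) * prod_list (map h u) +
        gen_elt g * (prod_list (map h u) - Poly_Mapping.single (Word u) 1) \<in> II"
      by (intro ideal_add ideal_mult h) (auto intro: free_alg_closed)
    moreover have "gen_elt g * Poly_Mapping.single (Word u) 1 = Poly_Mapping.single (Word (g # u)) 1"
      by (simp add: gen_elt_def mult_single plus_word_def)
    ultimately show ?case
      using Cons h by (auto simp: algebra_simps intro: free_alg_mult_closed)
  qed
  from ideal_scale[OF conjunct2[OF prod_list[OF single]], of c] show ?case
    by (simp add: subst_single scale_diff_right)
next
  case (add f g)
  then show ?case
    using ideal_add[of "subst h f - f" "subst h g - g"] by (simp add: subst_linear algebra_simps)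
qed (simp add: subst_linear ideal_zero)

locale presentation_hom = P: presentation G Rel + Q: presentation G' Rel' for G Rel G' Rel' +
  fixes h :: "gen \<Rightarrow> free"
  assumes h_part: "g \<in> G \<Longrightarrow> h g \<in> part (free_alg G') (par_gen g)"
    and h_rel: "r \<in> Rel \<Longrightarrow> subst h r \<in> rel_ideal G' Rel'"
begin

text \<open>The union over representatives avoids a choice; it is a single class because
  \<open>subst h\<close> respects the ideals.\<close>

definition induced :: "free set \<Rightarrow> free set" where
  "induced Z = (\<Union>x\<in>Z. Q.cl (subst h x))"

lemma h_closed: "g \<in> G \<Longrightarrow> h g \<in> carrier Q.FF"
  using h_part by (auto simp: free_alg_part)

lemma subst_h_closed: "f \<in> carrier P.FF \<Longrightarrow> subst h f \<in> carrier Q.FF"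
  by (rule subst_closed[OF _ h_closed])

text \<open>The preimage of the target ideal is an ideal containing \<open>Rel\<close>, so
  minimality of the generated ideal applies.\<close>

lemma subst_ideal:
  assumes "f \<in> P.II"
  shows "subst h f \<in> Q.II"
proof -
  interpret ring_hom_ring P.FF Q.FF "subst h"
    by (rule subst_ring_hom) (rule h_closed)
  have "ideal {f \<in> carrier P.FF. subst h f \<in> Q.II} P.FF"
    by (rule ideal_vimage[OF Q.I.ideal_axioms])
  then have "P.II \<subseteq> {f \<in> carrier P.FF. subst h f \<in> Q.II}"
    unfolding rel_ideal_def[of G]
    by (rule P.F.genideal_minimal) (use P.rels h_rel in auto)
  then show ?thesis
    using assms by blast
qed

lemma induced_cl:
  assumes "f \<in> carrier P.FF"
  shows "induced (P.cl f) = Q.cl (subst h f)"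
proof -
  have "Q.cl (subst h x) = Q.cl (subst h f)" if "x \<in> P.cl f" for x
    using that assms subst_ideal[of "x - f"]
    by (auto simp: P.mem_cl_iff P.cl_eq_iff Q.cl_eq_iff subst_h_closed subst_linear)
  then show ?thesis
    using P.cl_self[OF assms] unfolding induced_def by blast
qed

lemma induced_closed: "x \<in> carrier P.QQ \<Longrightarrow> induced x \<in> carrier Q.QQ"
  by (auto simp: P.carrier_presented induced_cl Q.cl_closed subst_h_closed)

lemma induced_ring_hom: "induced \<in> ring_hom P.QQ Q.QQ"
  by (rule ring_hom_memI)
    (auto simp: P.carrier_presented induced_cl P.cl_mult P.cl_add P.cl_one Q.cl_mult Q.cl_add Q.cl_one
      subst_linear subst_mult Q.cl_closed subst_h_closed free_alg_mult_closed free_alg_add_closed free_alg_closed)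

lemma induced_smult: "x \<in> carrier P.QQ \<Longrightarrow> induced (c \<odot>\<^bsub>P.QQ\<^esub> x) = c \<odot>\<^bsub>Q.QQ\<^esub> induced x"
  by (auto simp: P.carrier_presented induced_cl P.cl_scale Q.cl_scale subst_linear subst_h_closed free_alg_scale_closed)

lemma induced_part: "induced ` part P.QQ p \<subseteq> part Q.QQ p"
proof -
  have "induced (P.cl f) \<in> part Q.QQ p" if "f \<in> part P.FF p" for f
  proof -
    have "f \<in> carrier P.FF"
      using that by (simp add: free_alg_part)
    then show ?thesis
      using subst_part[OF that h_part] by (auto simp: induced_cl Q.part_presented)
  qed
  then show ?thesis
    by (auto simp: P.part_presented)
qed

end

text \<open>The substitutions need to be inverse only on generators and only modulo the relations.
  The freedom matters: a generator with positive first index comes back as a multiple of the one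
  with both indices negated.\<close>

lemma induced_ring_iso:
  assumes "presentation_hom G Rel G' Rel' h" "presentation_hom G' Rel' G Rel k"
    and kh: "\<And>g. g \<in> G \<Longrightarrow> subst k (h g) - gen_elt g \<in> rel_ideal G Rel"
    and hk: "\<And>g. g \<in> G' \<Longrightarrow> subst h (k g) - gen_elt g \<in> rel_ideal G' Rel'"
  shows "presentation_hom.induced G' Rel' h \<in> ring_iso (presented G Rel) (presented G' Rel')"
proof -
  interpret h: presentation_hom G Rel G' Rel' h by fact
  interpret k: presentation_hom G' Rel' G Rel k by fact
  have "k.induced (h.induced x) = x" if "x \<in> carrier h.P.QQ" for x
  proof -
    from that obtain f where f: "f \<in> carrier h.P.FF" "x = h.P.cl f"
      by (auto simp: h.P.carrier_presented)
    have "subst k (subst h f) - f \<in> h.P.II"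
      unfolding subst_subst by (rule h.P.subst_congruent[OF f(1)]) (auto intro: kh h.h_closed k.subst_h_closed)
    then show ?thesis
      using f by (simp add: h.induced_cl k.induced_cl h.subst_h_closed k.subst_h_closed h.P.cl_eq_iff)
  qed
  moreover have "h.induced (k.induced x) = x" if "x \<in> carrier h.Q.QQ" for x
  proof -
    from that obtain f where f: "f \<in> carrier h.Q.FF" "x = h.Q.cl f"
      by (auto simp: h.Q.carrier_presented)
    have "subst h (subst k f) - f \<in> h.Q.II"
      unfolding subst_subst by (rule h.Q.subst_congruent[OF f(1)]) (auto intro: hk k.h_closed h.subst_h_closed)
    then show ?thesis
      using f by (simp add: h.induced_cl k.induced_cl h.subst_h_closed k.subst_h_closed h.Q.cl_eq_iff)
  qed
  ultimately have "bij_betw h.induced (carrier h.P.QQ) (carrier h.Q.QQ)"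
    by (intro bij_betw_byWitness[where f' = k.induced]) (auto intro: h.induced_closed k.induced_closed)
  then show ?thesis
    using h.induced_ring_hom by (simp add: ring_iso_def)
qed

section \<open>Equivariance is decided on generators\<close>

lemma supermoduleD:
  assumes "supermodule V M \<rho>"
  shows "u \<in> carrier V \<Longrightarrow> x \<in> carrier M \<Longrightarrow> \<rho> u x \<in> carrier M"
    "u \<in> carrier V \<Longrightarrow> v \<in> carrier V \<Longrightarrow> x \<in> carrier M \<Longrightarrow> \<rho> (u \<oplus>\<^bsub>V\<^esub> v) x = \<rho> u x \<oplus>\<^bsub>M\<^esub> \<rho> v x"
    "u \<in> carrier V \<Longrightarrow> x \<in> carrier M \<Longrightarrow> \<rho> (c \<odot>\<^bsub>V\<^esub> u) x = c \<odot>\<^bsub>M\<^esub> \<rho> u x"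
    "u \<in> carrier V \<Longrightarrow> v \<in> carrier V \<Longrightarrow> x \<in> carrier M \<Longrightarrow> \<rho> (u \<otimes>\<^bsub>V\<^esub> v) x = \<rho> u (\<rho> v x)"
    "x \<in> carrier M \<Longrightarrow> \<rho> \<one>\<^bsub>V\<^esub> x = x"
    "u \<in> carrier V \<Longrightarrow> x \<in> carrier M \<Longrightarrow> x' \<in> carrier M \<Longrightarrow> \<rho> u (x \<oplus>\<^bsub>M\<^esub> x') = \<rho> u x \<oplus>\<^bsub>M\<^esub> \<rho> u x'"
    "u \<in> carrier V \<Longrightarrow> x \<in> carrier M \<Longrightarrow> \<rho> u (c \<odot>\<^bsub>M\<^esub> x) = c \<odot>\<^bsub>M\<^esub> \<rho> u x"
  using assms by (simp_all add: supermodule_def)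

text \<open>The assumption on generators provides one linear \<open>f\<close> that describes both
  actions at once: \<open>\<rho>\<close> yields its class and \<open>\<sigma>\<close> the class of
  its image.\<close>

locale equivariance = presentation_hom G Rel G' Rel' h for G Rel G' Rel' h +
  fixes n :: nat and \<rho> \<sigma> :: "free set \<Rightarrow> free set \<Rightarrow> free set"
  assumes P_action: "supermodule_superalgebra n (presented G Rel) \<rho>"
    and Q_action: "supermodule_superalgebra n (presented G' Rel') \<sigma>"
    and on_generators: "\<And>g i j. g \<in> G \<Longrightarrow> Lgen i j \<in> U_gens n \<Longrightarrow>
      \<exists>f. Poly_Mapping.keys f \<subseteq> (\<lambda>g. Word [g]) ` G \<and>
        \<rho> (L_elt n i j) (cls G Rel (gen_elt g)) = cls G Rel f \<and>
        \<sigma> (L_elt n i j) (cls G' Rel' (h g)) = cls G' Rel' (subst h f)"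
begin

sublocale U: presentation "U_gens n" "U_rels n"
  by unfold_locales (rule U_rels_closed)

lemma Uq_eq: "Uq n = U.QQ" "Ucls n = U.cl"
  by (simp_all add: Uq_def Ucls_def)

lemma P_supermodule: "supermodule U.QQ P.QQ \<rho>" and Q_supermodule: "supermodule U.QQ Q.QQ \<sigma>"
  using P_action Q_action by (simp_all add: supermodule_superalgebra_def Uq_eq)

lemma P_ring: "ring P.QQ" and Q_ring: "ring Q.QQ"
  using P_action Q_action by (simp_all add: supermodule_superalgebra_def is_superalgebra_def)

lemma action_closed:
  "u \<in> carrier U.FF \<Longrightarrow> x \<in> carrier P.QQ \<Longrightarrow> \<rho> (U.cl u) x \<in> carrier P.QQ"
  "u \<in> carrier U.FF \<Longrightarrow> y \<in> carrier Q.QQ \<Longrightarrow> \<sigma> (U.cl u) y \<in> carrier Q.QQ"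
  by (simp_all add: supermoduleD(1)[OF P_supermodule] supermoduleD(1)[OF Q_supermodule] U.cl_closed)

lemma action_linear:
  assumes "u \<in> carrier U.FF" "v \<in> carrier U.FF"
  shows "x \<in> carrier P.QQ \<Longrightarrow> \<rho> (U.cl (u + v)) x = \<rho> (U.cl u) x \<oplus>\<^bsub>P.QQ\<^esub> \<rho> (U.cl v) x"
    "x \<in> carrier P.QQ \<Longrightarrow> \<rho> (U.cl (scale c u)) x = c \<odot>\<^bsub>P.QQ\<^esub> \<rho> (U.cl u) x"
    "x \<in> carrier P.QQ \<Longrightarrow> \<rho> (U.cl (u * v)) x = \<rho> (U.cl u) (\<rho> (U.cl v) x)"
    "x \<in> carrier P.QQ \<Longrightarrow> \<rho> (U.cl 1) x = x"
    "x \<in> carrier P.QQ \<Longrightarrow> x' \<in> carrier P.QQ \<Longrightarrow> \<rho> (U.cl u) (x \<oplus>\<^bsub>P.QQ\<^esub> x') = \<rho> (U.cl u) x \<oplus>\<^bsub>P.QQ\<^esub> \<rho> (U.cl u) x'"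
    "x \<in> carrier P.QQ \<Longrightarrow> \<rho> (U.cl u) (c \<odot>\<^bsub>P.QQ\<^esub> x) = c \<odot>\<^bsub>P.QQ\<^esub> \<rho> (U.cl u) x"
    "y \<in> carrier Q.QQ \<Longrightarrow> \<sigma> (U.cl (u + v)) y = \<sigma> (U.cl u) y \<oplus>\<^bsub>Q.QQ\<^esub> \<sigma> (U.cl v) y"
    "y \<in> carrier Q.QQ \<Longrightarrow> \<sigma> (U.cl (scale c u)) y = c \<odot>\<^bsub>Q.QQ\<^esub> \<sigma> (U.cl u) y"
    "y \<in> carrier Q.QQ \<Longrightarrow> \<sigma> (U.cl (u * v)) y = \<sigma> (U.cl u) (\<sigma> (U.cl v) y)"
    "y \<in> carrier Q.QQ \<Longrightarrow> \<sigma> (U.cl 1) y = y"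
    "y \<in> carrier Q.QQ \<Longrightarrow> y' \<in> carrier Q.QQ \<Longrightarrow> \<sigma> (U.cl u) (y \<oplus>\<^bsub>Q.QQ\<^esub> y') = \<sigma> (U.cl u) y \<oplus>\<^bsub>Q.QQ\<^esub> \<sigma> (U.cl u) y'"
    "y \<in> carrier Q.QQ \<Longrightarrow> \<sigma> (U.cl u) (c \<odot>\<^bsub>Q.QQ\<^esub> y) = c \<odot>\<^bsub>Q.QQ\<^esub> \<sigma> (U.cl u) y"
  unfolding U.cl_add[OF assms, symmetric] U.cl_mult[OF assms, symmetric]
    U.cl_scale[OF assms(1), symmetric] U.cl_one[symmetric]
  by (simp_all add: supermoduleD[OF P_supermodule] supermoduleD[OF Q_supermodule] U.cl_closed assms)

lemma induced_add: "x \<in> carrier P.QQ \<Longrightarrow> x' \<in> carrier P.QQ \<Longrightarrow>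
    induced (x \<oplus>\<^bsub>P.QQ\<^esub> x') = induced x \<oplus>\<^bsub>Q.QQ\<^esub> induced x'"
  and induced_mult: "x \<in> carrier P.QQ \<Longrightarrow> x' \<in> carrier P.QQ \<Longrightarrow>
    induced (x \<otimes>\<^bsub>P.QQ\<^esub> x') = induced x \<otimes>\<^bsub>Q.QQ\<^esub> induced x'"
  by (rule ring_hom_add[OF induced_ring_hom] ring_hom_mult[OF induced_ring_hom]; assumption)+

section \<open>Invariance of the span of the generators\<close>

definition gen_span :: "free set" where
  "gen_span = {f. Poly_Mapping.keys f \<subseteq> (\<lambda>g. Word [g]) ` G}"

lemma gen_span_closed: "f \<in> gen_span \<Longrightarrow> f \<in> carrier P.FF"
  by (auto simp: gen_span_def free_alg_carrier)

lemma gen_span_add: "f \<in> gen_span \<Longrightarrow> g \<in> gen_span \<Longrightarrow> f + g \<in> gen_span"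
  unfolding gen_span_def using keys_add[of f g] by blast

lemma gen_span_scale: "f \<in> gen_span \<Longrightarrow> scale c f \<in> gen_span"
  unfolding gen_span_def using keys_scale[of c f] by blast

text \<open>Stronger than equivariance at \<open>f\<close>: the result must again be linear in the
  generators. This half lets the property pass to a product \<open>u * v\<close>, where
  \<open>u\<close> acts on what \<open>v\<close> has produced.\<close>

definition preserves :: "free \<Rightarrow> free \<Rightarrow> bool" where
  "preserves u f \<longleftrightarrow> (\<exists>f'\<in>gen_span. \<rho> (U.cl u) (P.cl f) = P.cl f' \<and> \<sigma> (U.cl u) (induced (P.cl f)) = induced (P.cl f'))"

lemma preserves_add_left:
  assumes "u \<in> carrier U.FF" "v \<in> carrier U.FF" "f \<in> gen_span" "preserves u f" "preserves v f"
  shows "preserves (u + v) f"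
proof -
  from assms obtain p r where pr: "p \<in> gen_span" "r \<in> gen_span"
    and "\<rho> (U.cl u) (P.cl f) = P.cl p" "\<sigma> (U.cl u) (induced (P.cl f)) = induced (P.cl p)"
      "\<rho> (U.cl v) (P.cl f) = P.cl r" "\<sigma> (U.cl v) (induced (P.cl f)) = induced (P.cl r)"
    unfolding preserves_def by blast
  then have "\<rho> (U.cl (u + v)) (P.cl f) = P.cl (p + r)"
    "\<sigma> (U.cl (u + v)) (induced (P.cl f)) = induced (P.cl (p + r))"
    using assms(1-3)
    by (simp_all add: action_linear(1,7) P.cl_closed gen_span_closed induced_closed induced_add
      P.cl_add[symmetric])
  then show ?thesis
    using gen_span_add[OF pr] unfolding preserves_def by blast
qed

lemma preserves_scale_left:
  assumes "u \<in> carrier U.FF" "f \<in> gen_span" "preserves u f"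
  shows "preserves (scale c u) f"
proof -
  from assms obtain p where p: "p \<in> gen_span"
    and "\<rho> (U.cl u) (P.cl f) = P.cl p" "\<sigma> (U.cl u) (induced (P.cl f)) = induced (P.cl p)"
    unfolding preserves_def by blast
  then have "\<rho> (U.cl (scale c u)) (P.cl f) = P.cl (scale c p)"
    "\<sigma> (U.cl (scale c u)) (induced (P.cl f)) = induced (P.cl (scale c p))"
    using assms(1-2)
    by (simp_all add: action_linear(2,8) P.cl_closed gen_span_closed induced_closed induced_smult
      P.cl_scale[symmetric])
  then show ?thesis
    using gen_span_scale[OF p] unfolding preserves_def by blast
qed

lemma preserves_add_right:
  assumes "u \<in> carrier U.FF" "f \<in> gen_span" "g \<in> gen_span" "preserves u f" "preserves u g"
  shows "preserves u (f + g)"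
proof -
  from assms obtain p r where pr: "p \<in> gen_span" "r \<in> gen_span"
    and "\<rho> (U.cl u) (P.cl f) = P.cl p" "\<sigma> (U.cl u) (induced (P.cl f)) = induced (P.cl p)"
      "\<rho> (U.cl u) (P.cl g) = P.cl r" "\<sigma> (U.cl u) (induced (P.cl g)) = induced (P.cl r)"
    unfolding preserves_def by blast
  then have "\<rho> (U.cl u) (P.cl (f + g)) = P.cl (p + r)"
    "\<sigma> (U.cl u) (induced (P.cl (f + g))) = induced (P.cl (p + r))"
    using assms(1-3)
    by (simp_all add: action_linear(5,11) P.cl_closed gen_span_closed induced_closed induced_add
      P.cl_add[symmetric])
  then show ?thesis
    using gen_span_add[OF pr] unfolding preserves_def by blast
qed

lemma preserves_scale_right:
  assumes "u \<in> carrier U.FF" "f \<in> gen_span" "preserves u f"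
  shows "preserves u (scale c f)"
proof -
  from assms obtain p where p: "p \<in> gen_span"
    and "\<rho> (U.cl u) (P.cl f) = P.cl p" "\<sigma> (U.cl u) (induced (P.cl f)) = induced (P.cl p)"
    unfolding preserves_def by blast
  then have "\<rho> (U.cl u) (P.cl (scale c f)) = P.cl (scale c p)"
    "\<sigma> (U.cl u) (induced (P.cl (scale c f))) = induced (P.cl (scale c p))"
    using assms(1-2)
    by (simp_all add: action_linear(6,12) P.cl_closed gen_span_closed induced_closed induced_smult
      P.cl_scale[symmetric])
  then show ?thesis
    using gen_span_scale[OF p] unfolding preserves_def by blast
qed

lemma preserves_mult:
  assumes "u \<in> carrier U.FF" "v \<in> carrier U.FF" "f \<in> gen_span"
    "\<And>f. f \<in> gen_span \<Longrightarrow> preserves u f" "preserves v f"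
  shows "preserves (u * v) f"
proof -
  from assms(5) obtain p where p: "p \<in> gen_span"
    and "\<rho> (U.cl v) (P.cl f) = P.cl p" "\<sigma> (U.cl v) (induced (P.cl f)) = induced (P.cl p)"
    unfolding preserves_def by blast
  moreover from assms(4)[OF p] obtain r where "r \<in> gen_span"
    "\<rho> (U.cl u) (P.cl p) = P.cl r" "\<sigma> (U.cl u) (induced (P.cl p)) = induced (P.cl r)"
    unfolding preserves_def by blast
  ultimately have "r \<in> gen_span" "\<rho> (U.cl (u * v)) (P.cl f) = P.cl r"
    "\<sigma> (U.cl (u * v)) (induced (P.cl f)) = induced (P.cl r)"
    using assms(1-3)
    by (simp_all add: action_linear(3,9) P.cl_closed gen_span_closed induced_closed)
  then show ?thesis
    unfolding preserves_def by blast
qed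

lemma preserves_one: "f \<in> gen_span \<Longrightarrow> preserves 1 f"
  using action_linear(4,10)[OF free_alg_closed(1) free_alg_closed(1)]
  unfolding preserves_def by (metis P.cl_closed gen_span_closed induced_closed)

lemma preserves_generator:
  assumes "t \<in> U_gens n" "f \<in> gen_span"
  shows "preserves (gen_elt t) f"
proof -
  from assms(1) obtain i j where ij: "t = Lgen i j" "i \<le> j"
    by (auto simp: U_gens_def)
  have t: "gen_elt t \<in> carrier U.FF"
    using assms(1) by (rule free_alg_closed)
  have single: "preserves (gen_elt t) (Poly_Mapping.single w c)" if "w \<in> (\<lambda>g. Word [g]) ` G" for w c
  proof -
    from that obtain g where g: "g \<in> G" "w = Word [g]" by blast
    then have span: "gen_elt g \<in> gen_span"
      by (auto simp: gen_span_def gen_elt_def)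
    obtain f where f: "f \<in> gen_span" "\<rho> (L_elt n i j) (P.cl (gen_elt g)) = P.cl f"
        "\<sigma> (L_elt n i j) (Q.cl (h g)) = Q.cl (subst h f)"
      using on_generators[OF g(1), of i j] assms(1) ij by (auto simp: gen_span_def)
    then have "preserves (gen_elt t) (gen_elt g)"
      using ij span by (auto simp: preserves_def L_elt_def Uq_eq induced_cl gen_span_closed)
    from preserves_scale_right[OF t span this, of c] show ?thesis
      by (simp add: g gen_elt_def)
  qed
  have span: "f \<in> gen_span" if "Poly_Mapping.keys f \<subseteq> (\<lambda>g. Word [g]) ` G" for f
    using that by (simp add: gen_span_def)
  from assms(2) have "Poly_Mapping.keys f \<subseteq> (\<lambda>g. Word [g]) ` G"
    by (simp add: gen_span_def)
  then show ?thesis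
  proof (induction rule: poly_mapping_linear_induct)
    case zero
    have "0 \<in> gen_span" by (simp add: gen_span_def)
    \<comment> \<open>Zero is treated as \<open>0\<close> times itself, and homogeneity of the
      action takes the scalar out.\<close>
    moreover have "\<rho> (U.cl (gen_elt t)) (P.cl 0) = P.cl 0"
      "\<sigma> (U.cl (gen_elt t)) (Q.cl 0) = Q.cl 0"
    proof -
      have zero: "P.cl 0 \<in> carrier P.QQ" "Q.cl 0 \<in> carrier Q.QQ"
        by (simp_all add: P.cl_closed Q.cl_closed free_alg_closed)
      have scale_zero: "0 \<odot>\<^bsub>P.QQ\<^esub> x = P.cl 0" if "x \<in> carrier P.QQ" for x
        using that by (auto simp: P.carrier_presented P.cl_scale)
      have scale_zero': "0 \<odot>\<^bsub>Q.QQ\<^esub> x = Q.cl 0" if "x \<in> carrier Q.QQ" for x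
        using that by (auto simp: Q.carrier_presented Q.cl_scale)
      show "\<rho> (U.cl (gen_elt t)) (P.cl 0) = P.cl 0" "\<sigma> (U.cl (gen_elt t)) (Q.cl 0) = Q.cl 0"
        using action_linear(6)[OF t t zero(1), of 0] action_linear(12)[OF t t zero(2), of 0]
          action_closed[OF t] zero by (simp_all add: scale_zero scale_zero')
    qed
    ultimately show ?case
      by (auto simp: preserves_def induced_cl free_alg_closed subst_linear)
  qed (auto intro: single span preserves_add_right[OF t])
qed

lemma preserves_all:
  assumes "u \<in> carrier U.FF" "f \<in> gen_span"
  shows "preserves u f"
  using assms(1)
proof (induction rule: free_alg_induct)
  case zero
  show ?case
    using preserves_scale_left[OF free_alg_closed(2) assms(2) preserves_one[OF assms(2)], of 0] by simp
next
  case (single w c)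
  have "preserves (Poly_Mapping.single (Word v) 1) f" if "set v \<subseteq> U_gens n" for v
    using that
  proof (induction v)
    case Nil
    then show ?case using preserves_one[OF assms(2)] by (simp flip: zero_word_def)
  next
    case (Cons t v)
    have "gen_elt t * Poly_Mapping.single (Word v) 1 = Poly_Mapping.single (Word (t # v)) 1"
      by (simp add: gen_elt_def mult_single plus_word_def)
    moreover have "preserves (gen_elt t * Poly_Mapping.single (Word v) 1) f"
      by (rule preserves_mult[OF _ _ assms(2)])
        (use Cons in \<open>auto intro: preserves_generator simp: free_alg_closed\<close>)
    ultimately show ?case by simp
  qed
  from preserves_scale_left[OF _ assms(2) this[OF single], of c] show ?case
    using single by (simp add: free_alg_closed)
qed (auto intro: preserves_add_left assms(2))

lemma equivariant_generator:
  assumes "u \<in> carrier U.FF" "g \<in> G"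
  shows "induced (\<rho> (U.cl u) (P.cl (gen_elt g))) = \<sigma> (U.cl u) (induced (P.cl (gen_elt g)))"
proof -
  have "gen_elt g \<in> gen_span"
    using assms(2) by (auto simp: gen_span_def gen_elt_def)
  from preserves_all[OF assms(1) this] show ?thesis
    by (auto simp: preserves_def)
qed

section \<open>From generators to products by means of the coproduct\<close>

lemma coprod_key:
  assumes "u \<in> carrier U.FF" "k \<in> Poly_Mapping.keys (coprod u)" "i < 2"
  shows "\<exists>v\<in>carrier U.FF. word_cls n (k ! i) = U.cl v"
proof -
  have "length k = 2" "list_all (leg_in (U_gens n)) k"
    using coprod_tens_in[OF assms(1)] assms(2) by (auto simp: tens_in_def)
  then have "leg_in (U_gens n) (k ! i)"
    using assms(3) by (simp add: list_all_length)
  then have "Poly_Mapping.single (leg_word (k ! i)) 1 \<in> carrier U.FF"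
    by (cases "k ! i") (auto simp: zero_word_def intro: free_alg_closed)
  then show ?thesis
    by (auto simp: word_cls_def Uq_eq)
qed

text \<open>Both actions on a product are the same sum over the terms of the coproduct. The sign
  there depends on the parity of \<open>a\<close>, which must be homogeneous and which
  \<open>induced\<close> keeps. Equivariance at \<open>a\<close> and \<open>b\<close> is required
  for every \<open>v\<close>, since the coproduct of \<open>u\<close> brings in other
  elements.\<close>

lemma equivariant_mult:
  assumes a: "a \<in> part P.QQ p" "a \<in> carrier P.QQ" and b: "b \<in> carrier P.QQ" and u: "u \<in> carrier U.FF"
    and equiv_a: "\<And>v. v \<in> carrier U.FF \<Longrightarrow> induced (\<rho> (U.cl v) a) = \<sigma> (U.cl v) (induced a)"
    and equiv_b: "\<And>v. v \<in> carrier U.FF \<Longrightarrow> induced (\<rho> (U.cl v) b) = \<sigma> (U.cl v) (induced b)"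
  shows "induced (\<rho> (U.cl u) (a \<otimes>\<^bsub>P.QQ\<^esub> b)) = \<sigma> (U.cl u) (induced (a \<otimes>\<^bsub>P.QQ\<^esub> b))"
proof -
  interpret P': ring P.QQ by (rule P_ring)
  interpret Q': ring Q.QQ by (rule Q_ring)
  interpret ring_hom_ring P.QQ Q.QQ induced
    by (rule ring_hom_ringI2[OF P_ring Q_ring induced_ring_hom])
  have smult_closed: "c \<odot>\<^bsub>P.QQ\<^esub> x \<in> carrier P.QQ" if "x \<in> carrier P.QQ" for c x
    using that by (auto simp: P.carrier_presented P.cl_scale free_alg_scale_closed)
  let ?c = "\<lambda>k. Poly_Mapping.lookup (coprod u) k * sg (par_leg (k ! 1) * p)"
  let ?t = "\<lambda>k. ?c k \<odot>\<^bsub>P.QQ\<^esub> (\<rho> (word_cls n (k ! 0)) a \<otimes>\<^bsub>P.QQ\<^esub> \<rho> (word_cls n (k ! 1)) b)"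
  let ?t' = "\<lambda>k. ?c k \<odot>\<^bsub>Q.QQ\<^esub> (\<sigma> (word_cls n (k ! 0)) (induced a) \<otimes>\<^bsub>Q.QQ\<^esub> \<sigma> (word_cls n (k ! 1)) (induced b))"
  have *: "?t k \<in> carrier P.QQ \<and> induced (?t k) = ?t' k \<and> ?t' k \<in> carrier Q.QQ"
    if k: "k \<in> Poly_Mapping.keys (coprod u)" for k
  proof -
    obtain v w where vw: "v \<in> carrier U.FF" "w \<in> carrier U.FF"
      "word_cls n (k ! 0) = U.cl v" "word_cls n (k ! 1) = U.cl w"
      using coprod_key[OF u k, of 0] coprod_key[OF u k, of 1] by auto
    have t: "?t k \<in> carrier P.QQ"
      using vw a b by (simp add: action_closed smult_closed)
    moreover have t': "induced (?t k) = ?t' k"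
      using vw a b by (simp add: action_closed induced_smult induced_mult equiv_a equiv_b)
    ultimately show ?thesis
      using induced_closed[OF t] by simp
  qed
  have ia: "induced a \<in> part Q.QQ p"
    using induced_part a(1) by blast
  have "induced (\<rho> (U.cl u) (a \<otimes>\<^bsub>P.QQ\<^esub> b)) = induced (\<Oplus>\<^bsub>P.QQ\<^esub>k\<in>Poly_Mapping.keys (coprod u). ?t k)"
    using P_action u a(1) b unfolding supermodule_superalgebra_def Uq_eq by simp
  also have "\<dots> = (\<Oplus>\<^bsub>Q.QQ\<^esub>k\<in>Poly_Mapping.keys (coprod u). induced (?t k))"
    using * by (subst hom_finsum) (auto simp: comp_def)
  also have "\<dots> = (\<Oplus>\<^bsub>Q.QQ\<^esub>k\<in>Poly_Mapping.keys (coprod u). ?t' k)"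
    using * by (intro Q'.finsum_cong') auto
  also have "\<dots> = \<sigma> (U.cl u) (induced a \<otimes>\<^bsub>Q.QQ\<^esub> induced b)"
    using Q_action u ia induced_closed[OF b] unfolding supermodule_superalgebra_def Uq_eq by simp
  also have "\<dots> = \<sigma> (U.cl u) (induced (a \<otimes>\<^bsub>P.QQ\<^esub> b))"
    using a b by (simp add: induced_mult)
  finally show ?thesis .
qed

theorem equivariant:
  assumes "u \<in> carrier (Uq n)" "x \<in> carrier P.QQ"
  shows "induced (\<rho> u x) = \<sigma> u (induced x)"
proof -
  from assms obtain v f where v: "v \<in> carrier U.FF" "u = U.cl v" and f: "f \<in> carrier P.FF" "x = P.cl f"
    by (auto simp: Uq_eq U.carrier_presented P.carrier_presented)
  have one: "induced (\<rho> (U.cl v) (P.cl 1)) = \<sigma> (U.cl v) (induced (P.cl 1))" if "v \<in> carrier U.FF" for v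
  proof -
    have "\<rho> (U.cl v) (P.cl 1) = counit v \<odot>\<^bsub>P.QQ\<^esub> P.cl 1" "\<sigma> (U.cl v) (Q.cl 1) = counit v \<odot>\<^bsub>Q.QQ\<^esub> Q.cl 1"
      using P_action Q_action that
      by (simp_all add: supermodule_superalgebra_def Uq_eq P.cl_one[symmetric] Q.cl_one[symmetric])
    then show ?thesis
      by (simp add: induced_smult P.cl_closed free_alg_closed induced_cl)
  qed
  have scale: "induced (\<rho> (U.cl v) (P.cl (scale c f))) = \<sigma> (U.cl v) (induced (P.cl (scale c f)))"
    if "v \<in> carrier U.FF" "f \<in> carrier P.FF" "induced (\<rho> (U.cl v) (P.cl f)) = \<sigma> (U.cl v) (induced (P.cl f))" for v f c
    using that
    by (simp add: action_linear(6,12)[OF that(1) that(1)] action_closed induced_smult induced_closed P.cl_closed P.cl_scale[symmetric])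
  have "induced (\<rho> (U.cl v) (P.cl f)) = \<sigma> (U.cl v) (induced (P.cl f))" if "v \<in> carrier U.FF" for v
    using f(1)
  proof (induction rule: free_alg_induct)
    case zero
    show ?case
      using scale[OF that _ one[OF that], of 0] by (simp add: free_alg_closed)
  next
    case (single w c)
    have "induced (\<rho> (U.cl v) (P.cl (Poly_Mapping.single (Word t) 1))) =
        \<sigma> (U.cl v) (induced (P.cl (Poly_Mapping.single (Word t) 1)))"
      if "set t \<subseteq> G" "v \<in> carrier U.FF" for t v
      using that
    \<comment> \<open>The acting element must vary, because the tail of the word is acted on by
      factors from the coproduct of \<open>v\<close>. A single letter is split off on the left since
      it is homogeneous.\<close>
    proof (induction t arbitrary: v)
      case Nil
      then show ?case using one by (simp flip: zero_word_def)
    next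
      case (Cons g t)
      have "gen_elt g * Poly_Mapping.single (Word t) 1 = Poly_Mapping.single (Word (g # t)) 1"
        by (simp add: gen_elt_def mult_single plus_word_def)
      moreover have g: "gen_elt g \<in> carrier P.FF" "Poly_Mapping.single (Word t) 1 \<in> carrier P.FF"
        using Cons.prems by (auto simp: free_alg_closed)
      moreover have "gen_elt g \<in> part P.FF (par_gen g)"
        using g by (simp add: free_alg_part) (simp add: gen_elt_def)
      then have "P.cl (gen_elt g) \<in> part P.QQ (par_gen g)"
        by (simp add: P.part_presented)
      then have "induced (\<rho> (U.cl v) (P.cl (gen_elt g) \<otimes>\<^bsub>P.QQ\<^esub> P.cl (Poly_Mapping.single (Word t) 1))) =
        \<sigma> (U.cl v) (induced (P.cl (gen_elt g) \<otimes>\<^bsub>P.QQ\<^esub> P.cl (Poly_Mapping.single (Word t) 1)))"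
        by (rule equivariant_mult) (use Cons g in \<open>simp_all add: P.cl_closed equivariant_generator\<close>)
      ultimately show ?case
        by (simp add: P.cl_mult)
    qed
    from scale[OF that _ this[OF single that], of c] show ?case
      using single by (simp add: free_alg_closed)
  next
    case (add f g)
    then show ?case
      using that
      by (simp add: action_linear(5,11)[OF that that] action_closed induced_add induced_closed P.cl_closed P.cl_add[symmetric])
  qed
  then show ?thesis
    using v f by simp
qed

end

section \<open>The isomorphism\<close>

text \<open>The term of \<open>J\<close> with row \<open>b\<close> is \<open>E b (- b)\<close> with
  sign \<open>sg (par (- b))\<close>, so row \<open>b\<close> of the product is this multiple of row
  \<open>- b\<close>. The second clause is a default for generators outside the shifted
  algebra.\<close>

fun tau_gen :: "gen \<Rightarrow> free" where
  "tau_gen (Pgen \<alpha> b) = scale (sg (par (- b))) (gen_elt (Tgen \<alpha> (- b)))"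
| "tau_gen g = gen_elt g"

text \<open>For \<open>\<alpha> > 0\<close> the generator is first rewritten as \<open>\<plusminus>\<close> the one with indices \<open>- \<alpha>, - b\<close>.\<close>

fun tau_inv_gen :: "gen \<Rightarrow> free" where
  "tau_inv_gen (Tgen \<alpha> b) =
    (if \<alpha> < 0 then scale (sg (par b)) (gen_elt (Pgen \<alpha> (- b)))
     else scale (sg (par \<alpha> + par b) * sg (par (- b))) (gen_elt (Pgen (- \<alpha>) b)))"
| "tau_inv_gen g = gen_elt g"

lemma gen_elt_part: "g \<in> G \<Longrightarrow> gen_elt g \<in> part (free_alg G) (par_gen g)"
  using free_alg_closed(4)[of g G] by (simp add: free_alg_part) (simp add: gen_elt_def)

lemma scale_part: "f \<in> part (free_alg G) p \<Longrightarrow> scale c f \<in> part (free_alg G) p"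
  using keys_scale[of c f] by (auto simp: free_alg_part free_alg_scale_closed)

lemma tau_gen_part:
  assumes "g \<in> APi_gens l n"
  shows "tau_gen g \<in> part (free_alg (A_gens l n)) (par_gen g)"
proof -
  from assms obtain \<alpha> b where g: "g = Pgen \<alpha> b" "\<alpha> \<in> neg_idx l" "b \<in> idx n"
    by (auto simp: APi_gens_def)
  have "par_gen g = par_gen (Tgen \<alpha> (- b))"
    using g idx_nonzero[of b n] by (simp add: neg_idx_iff par_neg par_uminus add.commute add.assoc)
  moreover have "Tgen \<alpha> (- b) \<in> A_gens l n"
    using g by (auto simp: A_gens_def neg_idx_iff)
  note scale_part[OF gen_elt_part[OF this], of "sg (par (- b))"]
  ultimately show ?thesis
    by (simp only: g tau_gen.simps)
qed

lemma tau_inv_gen_part: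
  assumes "g \<in> A_gens l n"
  shows "tau_inv_gen g \<in> part (free_alg (APi_gens l n)) (par_gen g)"
proof -
  from assms obtain \<alpha> b where g: "g = Tgen \<alpha> b" "\<alpha> \<in> idx l" "b \<in> idx n"
    by (auto simp: A_gens_def)
  show ?thesis
  proof (cases "\<alpha> < 0")
    case True
    then have "par_gen g = par_gen (Pgen \<alpha> (- b))"
      using g idx_nonzero[of b n] by (simp add: par_neg par_uminus add.commute)
    moreover have "Pgen \<alpha> (- b) \<in> APi_gens l n"
      using g True by (auto simp: APi_gens_def neg_idx_iff)
    note scale_part[OF gen_elt_part[OF this], of "sg (par b)"]
    ultimately show ?thesis
      using True by (simp only: g tau_inv_gen.simps if_True)
  next
    case False
    then have "par_gen g = par_gen (Pgen (- \<alpha>) b)"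
      using g by (simp add: par_def)
    moreover have "Pgen (- \<alpha>) b \<in> APi_gens l n"
      using g False idx_nonzero[of \<alpha> l] by (auto simp: APi_gens_def neg_idx_iff)
    note scale_part[OF gen_elt_part[OF this], of "sg (par \<alpha> + par b) * sg (par (- b))"]
    ultimately show ?thesis
      using False by (simp only: g tau_inv_gen.simps if_False)
  qed
qed

text \<open>The symmetry holds literally in the free algebra. It kills the linear relations outright
  and supplies the hypothesis \<open>sym\<close> for the reductions of the quadratic ones.\<close>

lemma tau_inv_gen_uminus:
  assumes "\<alpha> \<noteq> 0" "b \<noteq> 0"
  shows "tau_inv_gen (Tgen (- \<alpha>) (- b)) = scale (sg (par \<alpha> + par b)) (tau_inv_gen (Tgen \<alpha> b))"
  using assms by (auto simp: par_uminus par_def)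

section \<open>The two substitutions respect the relations\<close>

lemma tau_rel:
  assumes "r \<in> APi_rels l n"
  shows "subst tau_gen r \<in> rel_ideal (A_gens l n) (A_rels l n)"
proof -
  interpret A: presentation "A_gens l n" "A_rels l n"
    by unfold_locales (rule A_rels_closed)
  from assms obtain ms where r: "r = entry
      (place 3 [1, 3] (Tcheck_minus l n) \<bullet>\<^sub>T place 3 [2, 3] (Tcheck_minus l n) \<bullet>\<^sub>T place 3 [1, 2] (Rmat_minus l) -
       place 3 [1, 2] (SJmat n) \<bullet>\<^sub>T place 3 [2, 3] (Tcheck_minus l n) \<bullet>\<^sub>T place 3 [1, 3] (Tcheck_minus l n)) ms"
    by (auto simp: APi_rels_def entry_rels_def)
  show ?thesis
  proof (cases "\<exists>b\<in>idx n. \<exists>d\<in>idx n. \<exists>k\<in>neg_idx l. \<exists>m\<in>neg_idx l. ms = [(b, k), (d, m)]")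
    case True
    then obtain b d k m where mem: "b \<in> idx n" "d \<in> idx n" "k \<in> neg_idx l" "m \<in> neg_idx l"
      and ms: "ms = [(b, k), (d, m)]" by blast
    have "subst tau_gen r = quad_rel_minus l n (\<lambda>\<alpha> c. tau_gen (Pgen \<alpha> c)) b k d m"
      unfolding r ms entry_APi_rel[OF mem] subst_quad_rel_minus subst_gen_elt ..
    also have "\<dots> = scale (sg (par d)) (quad_rel l n (\<lambda>\<alpha> c. gen_elt (Tgen \<alpha> c)) (- b) k (- d) m)"
      by (rule quad_rel_minus_eq[OF _ mem]) simp
    also have "quad_rel l n (\<lambda>\<alpha> c. gen_elt (Tgen \<alpha> c)) (- b) k (- d) m \<in> A_rels l n"
      using mem unfolding A_rels_def entry_rels_def
      by (subst entry_A_rel[symmetric]) (auto simp: neg_idx_iff)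
    then have "scale (sg (par d)) (quad_rel l n (\<lambda>\<alpha> c. gen_elt (Tgen \<alpha> c)) (- b) k (- d) m) \<in> A.II"
      by (intro A.ideal_scale A.rel_in_ideal)
    finally show ?thesis .
  next
    case False
    then have "r = 0"
      unfolding r entry_linear Rmat_minus_eq SJmat_eq Tcheck_minus_eq
      entry_TTS_zero[OF idx_simps(2,1) False] entry_STT_zero[OF idx_simps(2,1) False] by simp
    then show ?thesis
      by (simp add: subst_linear A.ideal_zero)
  qed
qed

lemma tau_inv_rel:
  assumes "r \<in> A_rels l n"
  shows "subst tau_inv_gen r \<in> rel_ideal (APi_gens l n) (APi_rels l n)"
proof -
  interpret P: presentation "APi_gens l n" "APi_rels l n"
    by unfold_locales (rule APi_rels_closed)
  let ?T = "\<lambda>\<alpha> c. tau_inv_gen (Tgen \<alpha> c)"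
  have sym: "?T (- \<alpha>) (- c) = scale (sg (par \<alpha> + par c)) (?T \<alpha> c)" if "\<alpha> \<in> idx l" "c \<in> idx n" for \<alpha> c
    using that by (intro tau_inv_gen_uminus) (auto dest: idx_nonzero)
  \<comment> \<open>With both columns negative this is, up to sign, the defining relation of the
    shifted algebra at the rows \<open>- b\<close> and \<open>- d\<close>.\<close>
  have neg: "quad_rel l n ?T b k d m \<in> P.II"
    if mem: "b \<in> idx n" "d \<in> idx n" "k \<in> neg_idx l" "m \<in> neg_idx l" for b k d m
  proof -
    have mem': "- b \<in> idx n" "- d \<in> idx n"
      using mem by simp_all
    have "quad_rel_minus l n (\<lambda>\<alpha> c. gen_elt (Pgen \<alpha> c)) (- b) k (- d) m =
        scale (sg (par (- d))) (quad_rel l n ?T b k d m)"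
      by (subst quad_rel_minus_eq[OF _ mem' mem(3,4), where T = ?T]) (auto simp: neg_idx_iff)
    moreover have "quad_rel_minus l n (\<lambda>\<alpha> c. gen_elt (Pgen \<alpha> c)) (- b) k (- d) m \<in> APi_rels l n"
      unfolding APi_rels_def entry_rels_def entry_APi_rel[OF mem' mem(3,4), symmetric] by blast
    ultimately have "scale (sg (par (- d))) (quad_rel l n ?T b k d m) \<in> P.II"
      using P.rel_in_ideal by metis
    from P.ideal_scale[OF this, of "sg (par (- d))"] show ?thesis
      by simp
  qed
  have quad: "quad_rel l n ?T b k d m \<in> P.II"
    if mem: "b \<in> idx n" "d \<in> idx n" "k \<in> idx l" "m \<in> idx l" for b k d m
  proof -
    \<comment> \<open>All indices are generalised, because making \<open>m\<close> negative
      afterwards also replaces the row \<open>d\<close> by \<open>- d\<close>.\<close>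
    have neg_left: "quad_rel l n ?T b k d m \<in> P.II" if "m \<in> neg_idx l" "b \<in> idx n" "d \<in> idx n" "k \<in> idx l" for b k d m
    proof (cases "k < 0")
      case False
      then have "quad_rel l n ?T (- b) (- k) d m \<in> P.II"
        using that idx_nonzero[of k l] by (intro neg) (auto simp: neg_idx_iff)
      then show ?thesis
        using that by (subst (asm) quad_rel_uminus_left) (auto simp: neg_idx_iff sym simp del: tau_inv_gen.simps)
    qed (use that neg in \<open>auto simp: neg_idx_iff\<close>)
    show ?thesis
    proof (cases "m < 0")
      case False
      then have "quad_rel l n ?T b k (- d) (- m) \<in> P.II"
        using mem idx_nonzero[of m l] by (intro neg_left) (auto simp: neg_idx_iff)
      then show ?thesis
        using mem by (subst (asm) quad_rel_uminus_right) (auto simp: sym simp del: tau_inv_gen.simps)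
    qed (use mem neg_left in \<open>auto simp: neg_idx_iff\<close>)
  qed
  from assms consider
    (linear) \<alpha> b where "\<alpha> \<in> idx l" "b \<in> idx n"
      "r = gen_elt (Tgen \<alpha> b) - scale (sg (par \<alpha> + par b)) (gen_elt (Tgen (- \<alpha>) (- b)))"
  | (quadratic) ms where "r = entry
      (place 3 [1, 3] (Tbar l n) \<bullet>\<^sub>T place 3 [2, 3] (Tbar l n) \<bullet>\<^sub>T place 3 [1, 2] (Smat l) -
       place 3 [1, 2] (Smat n) \<bullet>\<^sub>T place 3 [2, 3] (Tbar l n) \<bullet>\<^sub>T place 3 [1, 3] (Tbar l n)) ms"
    unfolding A_rels_def entry_rels_def by blast
  then show ?thesis
  proof cases
    case linear
    then have "subst tau_inv_gen r = 0"
      by (simp add: subst_linear sym del: tau_inv_gen.simps)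
    then show ?thesis
      by (simp add: P.ideal_zero)
  next
    case quadratic
    show ?thesis
    proof (cases "\<exists>b\<in>idx n. \<exists>d\<in>idx n. \<exists>k\<in>idx l. \<exists>m\<in>idx l. ms = [(b, k), (d, m)]")
      case True
      then obtain b d k m where mem: "b \<in> idx n" "d \<in> idx n" "k \<in> idx l" "m \<in> idx l"
        and ms: "ms = [(b, k), (d, m)]" by blast
      show ?thesis
        unfolding quadratic ms entry_A_rel[OF mem] subst_quad_rel subst_gen_elt by (rule quad[OF mem])
    next
      case False
      then have "r = 0"
        unfolding quadratic entry_linear Smat_eq Tbar_eq
        entry_TTS_zero[OF idx_simps(1,1) False] entry_STT_zero[OF idx_simps(1,1) False] by simp
      then show ?thesis
        by (simp add: subst_linear P.ideal_zero)
    qed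
  qed
qed

lemma tau_hom: "presentation_hom (APi_gens l n) (APi_rels l n) (A_gens l n) (A_rels l n) tau_gen"
  by unfold_locales (use APi_rels_closed A_rels_closed tau_gen_part tau_rel in blast)+

lemma tau_inv_hom: "presentation_hom (A_gens l n) (A_rels l n) (APi_gens l n) (APi_rels l n) tau_inv_gen"
  by unfold_locales (use APi_rels_closed A_rels_closed tau_inv_gen_part tau_inv_rel in blast)+

definition tau :: "nat \<Rightarrow> nat \<Rightarrow> free set \<Rightarrow> free set" where
  "tau l n = presentation_hom.induced (A_gens l n) (A_rels l n) tau_gen"

lemma tau_ring_iso: "tau l n \<in> ring_iso (APi_bar l n) (A_bar l n)"
  unfolding tau_def APi_bar_def A_bar_def
proof (rule induced_ring_iso[OF tau_hom tau_inv_hom])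
  interpret A: presentation "A_gens l n" "A_rels l n"
    by unfold_locales (rule A_rels_closed)
  interpret P: presentation "APi_gens l n" "APi_rels l n"
    by unfold_locales (rule APi_rels_closed)
  show "subst tau_inv_gen (tau_gen g) - gen_elt g \<in> P.II" if "g \<in> APi_gens l n" for g
  proof -
    from that obtain \<alpha> b where "g = Pgen \<alpha> b" "\<alpha> < 0"
      by (auto simp: APi_gens_def neg_idx_iff)
    then show ?thesis
      by (simp add: subst_linear P.ideal_zero)
  qed
  show "subst tau_gen (tau_inv_gen g) - gen_elt g \<in> A.II" if g: "g \<in> A_gens l n" for g
  proof -
    from g obtain \<alpha> b where g: "g = Tgen \<alpha> b" "\<alpha> \<in> idx l" "b \<in> idx n"
      by (auto simp: A_gens_def)
    show ?thesis
    proof (cases "\<alpha> < 0")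
      case True
      then show ?thesis
        by (simp add: g subst_linear A.ideal_zero)
    next
      case False
      \<comment> \<open>For positive \<open>\<alpha>\<close> the composite minus the generator is
        \<open>- 1\<close> times this linear relation.\<close>
      have "gen_elt (Tgen \<alpha> b) - scale (sg (par \<alpha> + par b)) (gen_elt (Tgen (- \<alpha>) (- b))) \<in> A.II"
        using g by (intro A.rel_in_ideal) (auto simp: A_rels_def)
      from A.ideal_scale[OF this, of "- 1"] False show ?thesis
        by (simp add: g subst_linear scale_minus_left mult.assoc)
    qed
  qed
qed

section \<open>The action on the generators\<close>

lemma entry_tmat:
  assumes "finite A" "finite B" "\<alpha> \<in> A" "b \<in> B"
  shows "entry (tmat A B g \<theta>) [(b, \<alpha>)] = scale (\<theta> \<alpha> b) (gen_elt (g \<alpha> b))"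
  using assms by (simp add: tmat_def entry_linear if_conj sum_if_const gen_elt_def)

lemma entry_ST:
  assumes "finite A" "finite B" "\<alpha> \<in> A" "c \<in> B" "a \<in> B" "b \<in> B"
  shows "entry (place 3 [1, 3] (smat B s) \<bullet>\<^sub>T place 3 [1, 2] (tmat A B g \<theta>)) [(c, \<alpha>), (a, b)] =
    (\<Sum>e\<in>B. scale (s c e a b * \<theta> \<alpha> e * sg ((par a + par b) * (par e + par \<alpha>) + (par a + par b) * par_gen (g \<alpha> e)))
      (gen_elt (g \<alpha> e)))"
  by (simp add: tmat_def smat_def place_linear place_legs_simps tmult_sum tmult_single tleg_eval
    if_distrib[of "scale _"] entry_linear if_distrib[of "\<lambda>Z. entry Z _"] tmult_linear if_conj cong: if_cong)
    (simp add: assms sum_if_const gen_elt_def ac_simps)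

lemma entry_JT:
  assumes "\<alpha> \<in> neg_idx l" "b \<in> idx n"
  shows "entry (place 2 [1] (Jmat n) \<bullet>\<^sub>T Tbar_minus l n) [(b, \<alpha>)] = tau_gen (Pgen \<alpha> b)"
proof -
  have J: "Jmat n = (\<Sum>a\<in>idx n. Poly_Mapping.single [E a (- a)] (sg (par (- a))))"
    unfolding Jmat_def by (subst sum_idx_uminus[symmetric]) simp
  show ?thesis
    unfolding J place_linear tmult_sum(1)
    by (simp add: Tbar_minus_def place_legs_simps tmult_sum(2) tmult_single tleg_eval
      if_distrib[of "scale _"] entry_linear if_distrib[of "\<lambda>Z. entry Z _"] if_conj cong: if_cong)
      (simp add: assms sum_if_const gen_elt_def)
qed

text \<open>The characterizations of the actions give each value only up to a sign, which is its own
  inverse.\<close>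

lemma (in presentation) cl_unscale:
  assumes "x \<in> carrier QQ" "f \<in> carrier FF" "sg p \<odot>\<^bsub>QQ\<^esub> x = cl f"
  shows "x = cl (scale (sg p) f)"
proof -
  from assms(1) obtain g where g: "g \<in> carrier FF" "x = cl g"
    by (auto simp: carrier_presented)
  have "cl (scale (sg p) f) = sg p \<odot>\<^bsub>QQ\<^esub> (sg p \<odot>\<^bsub>QQ\<^esub> x)"
    using assms by (simp add: cl_scale)
  also have "\<dots> = x"
    using g by (simp add: cl_scale free_alg_scale_closed)
  finally show ?thesis ..
qed

lemma L_elt_closed: "Lgen a b \<in> U_gens n \<Longrightarrow> L_elt n a b \<in> carrier (Uq n)"
proof -
  interpret U: presentation "U_gens n" "U_rels n"
    by unfold_locales (rule U_rels_closed)
  show "Lgen a b \<in> U_gens n \<Longrightarrow> L_elt n a b \<in> carrier (Uq n)"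
    using U.cl_closed[OF free_alg_closed(4), of "Lgen a b"]
    by (auto simp: L_elt_def Uq_def Ucls_def U_gens_def)
qed

text \<open>The factor \<open>sg (par a + par b)\<close> appears because a matrix unit together with
  a shifted generator is odd, and \<open>E a b\<close> has to pass it. In the unshifted algebra the
  corresponding tensor is even and no such factor arises.\<close>

lemma Phi_bar_pi_generator:
  assumes "is_Phi_bar_pi l n \<Phi>\<pi>" "\<alpha> \<in> neg_idx l" "c \<in> idx n" "Lgen a b \<in> U_gens n"
  shows "\<Phi>\<pi> (L_elt n a b) (APi_cls l n (gen_elt (Pgen \<alpha> c))) =
    APi_cls l n (scale (sg ((par a + par b) * par c)) (\<Sum>e\<in>idx n.
      scale (scoef (- 1) c e a b * sg (par a + par b)) (gen_elt (Pgen \<alpha> e))))"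
proof -
  interpret P: presentation "APi_gens l n" "APi_rels l n"
    by unfold_locales (rule APi_rels_closed)
  have ab: "a \<in> idx n" "b \<in> idx n"
    using assms(4) by (auto simp: U_gens_def)
  have "entry (Tcheck_minus l n) [(c, \<alpha>)] = gen_elt (Pgen \<alpha> c)"
    using assms by (simp add: Tcheck_minus_eq entry_tmat)
  moreover have "entry (place 3 [1, 3] (Smat_inv n) \<bullet>\<^sub>T place 3 [1, 2] (Tcheck_minus l n)) [(c, \<alpha>), (a, b)] =
      (\<Sum>e\<in>idx n. scale (scoef (- 1) c e a b * sg (par a + par b)) (gen_elt (Pgen \<alpha> e)))"
    unfolding Smat_inv_eq Tcheck_minus_eq entry_ST[OF idx_simps(2,1) assms(2,3) ab]
  proof (intro sum.cong refl arg_cong2[where f = scale])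
    fix e
    have "par \<alpha> = 1"
      using assms(2) by (simp add: neg_idx_iff par_neg)
    then have "sg ((par a + par b) * (par e + par \<alpha>) + (par a + par b) * par_gen (Pgen \<alpha> e)) = sg (par a + par b)"
      by (cases "par a"; cases "par b"; cases "par e") simp_all
    then show "scoef (- 1) c e a b * 1 * sg ((par a + par b) * (par e + par \<alpha>) + (par a + par b) * par_gen (Pgen \<alpha> e)) =
        scoef (- 1) c e a b * sg (par a + par b)"
      by simp
  qed
  moreover have "sg ((par a + par b) * par c) \<odot>\<^bsub>APi_bar l n\<^esub>
        \<Phi>\<pi> (L_elt n a b) (APi_cls l n (entry (Tcheck_minus l n) [(c, \<alpha>)])) =
      APi_cls l n (entry (place 3 [1, 3] (Smat_inv n) \<bullet>\<^sub>T place 3 [1, 2] (Tcheck_minus l n)) [(c, \<alpha>), (a, b)])"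
    using assms ab by (simp add: is_Phi_bar_pi_def)
  moreover have gen: "gen_elt (Pgen \<alpha> e) \<in> carrier P.FF" if "e \<in> idx n" for e
    using that assms by (intro free_alg_closed) (auto simp: APi_gens_def)
  moreover have "supermodule (Uq n) (APi_bar l n) \<Phi>\<pi>"
    using assms(1) by (simp add: is_Phi_bar_pi_def supermodule_superalgebra_def)
  then have "\<Phi>\<pi> (L_elt n a b) (APi_cls l n (gen_elt (Pgen \<alpha> c))) \<in> carrier (APi_bar l n)"
    using supermoduleD(1) L_elt_closed[OF assms(4)] P.cl_closed[OF gen[OF assms(3)]]
    by (simp add: APi_bar_def APi_cls_def)
  ultimately show ?thesis
    unfolding APi_bar_def APi_cls_def
    by (intro P.cl_unscale) (auto intro!: free_alg_sum_closed free_alg_scale_closed)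
qed

lemma Phi_bar_generator:
  assumes "is_Phi_bar l n \<Phi>" "\<alpha> \<in> neg_idx l" "c \<in> idx n" "Lgen a b \<in> U_gens n"
  shows "\<Phi> (L_elt n a b) (A_cls l n (gen_elt (Tgen \<alpha> c))) =
    A_cls l n (scale (sg ((par a + par b) * (1 + par c))) (\<Sum>e\<in>idx n.
      scale (scoef (- 1) c e a b) (gen_elt (Tgen \<alpha> e))))"
proof -
  interpret A: presentation "A_gens l n" "A_rels l n"
    by unfold_locales (rule A_rels_closed)
  have ab: "a \<in> idx n" "b \<in> idx n" and \<alpha>: "\<alpha> \<in> idx l" "par \<alpha> = 1"
    using assms(2,4) by (auto simp: U_gens_def neg_idx_iff par_neg)
  \<comment> \<open>In a negative column the sign built into \<open>Tbar\<close> disappears, since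
    \<open>|e| (1 + |e|)\<close> is even.\<close>
  have sg_1: "sg (par e * (par \<alpha> + par e)) = 1" for e
    using \<alpha> by (cases "par e") simp_all
  have "entry (Tbar l n) [(c, \<alpha>)] = gen_elt (Tgen \<alpha> c)"
    using assms(3) \<alpha>(1) by (simp add: Tbar_eq entry_tmat sg_1)
  moreover have "entry (place 3 [1, 3] (Smat_inv n) \<bullet>\<^sub>T place 3 [1, 2] (Tbar l n)) [(c, \<alpha>), (a, b)] =
      (\<Sum>e\<in>idx n. scale (scoef (- 1) c e a b) (gen_elt (Tgen \<alpha> e)))"
    unfolding Smat_inv_eq Tbar_eq entry_ST[OF idx_simps(1,1) \<alpha>(1) assms(3) ab]
  proof (intro sum.cong refl arg_cong2[where f = scale])
    fix e
    have "sg ((par a + par b) * (par e + par \<alpha>) + (par a + par b) * par_gen (Tgen \<alpha> e)) = 1"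
      using \<alpha> by (cases "par a"; cases "par b"; cases "par e") simp_all
    then show "scoef (- 1) c e a b * sg (par e * (par \<alpha> + par e)) *
        sg ((par a + par b) * (par e + par \<alpha>) + (par a + par b) * par_gen (Tgen \<alpha> e)) = scoef (- 1) c e a b"
      by (simp only: sg_1 mult_1_right)
  qed
  moreover have "sg ((par a + par b) * (par \<alpha> + par c)) \<odot>\<^bsub>A_bar l n\<^esub>
        \<Phi> (L_elt n a b) (A_cls l n (entry (Tbar l n) [(c, \<alpha>)])) =
      A_cls l n (entry (place 3 [1, 3] (Smat_inv n) \<bullet>\<^sub>T place 3 [1, 2] (Tbar l n)) [(c, \<alpha>), (a, b)])"
    by (rule assms(1)[unfolded is_Phi_bar_def, THEN conjunct2, THEN bspec, OF \<alpha>(1), THEN bspec, OF assms(3),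
      THEN bspec, OF ab(1), THEN bspec, OF ab(2)])
  moreover have gen: "gen_elt (Tgen \<alpha> e) \<in> carrier A.FF" if "e \<in> idx n" for e
    using that \<alpha> by (intro free_alg_closed) (auto simp: A_gens_def)
  moreover have "supermodule (Uq n) (A_bar l n) \<Phi>"
    using assms(1) by (simp add: is_Phi_bar_def supermodule_superalgebra_def)
  then have "\<Phi> (L_elt n a b) (A_cls l n (gen_elt (Tgen \<alpha> c))) \<in> carrier (A_bar l n)"
    using supermoduleD(1) L_elt_closed[OF assms(4)] A.cl_closed[OF gen[OF assms(3)]]
    by (simp add: A_bar_def A_cls_def)
  ultimately show ?thesis
    unfolding A_bar_def A_cls_def \<alpha>(2)
    by (intro A.cl_unscale) (auto intro!: free_alg_sum_closed free_alg_scale_closed)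
qed

lemma tau_equivariance:
  assumes "is_Phi_bar l n \<Phi>" "is_Phi_bar_pi l n \<Phi>\<pi>"
  shows "equivariance (APi_gens l n) (APi_rels l n) (A_gens l n) (A_rels l n) tau_gen n \<Phi>\<pi> \<Phi>"
proof (intro equivariance.intro tau_hom equivariance_axioms.intro)
  interpret A: presentation "A_gens l n" "A_rels l n"
    by unfold_locales (rule A_rels_closed)
  show "supermodule_superalgebra n (presented (APi_gens l n) (APi_rels l n)) \<Phi>\<pi>"
    using assms(2) by (simp add: is_Phi_bar_pi_def APi_bar_def)
  show A_action: "supermodule_superalgebra n (presented (A_gens l n) (A_rels l n)) \<Phi>"
    using assms(1) by (simp add: is_Phi_bar_def A_bar_def)
  fix g a b assume g: "g \<in> APi_gens l n" and ab: "Lgen a b \<in> U_gens n"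
  from g obtain \<alpha> c where \<alpha>c: "g = Pgen \<alpha> c" "\<alpha> \<in> neg_idx l" "c \<in> idx n"
    by (auto simp: APi_gens_def)
  have ab': "a \<in> idx n" "b \<in> idx n"
    using ab by (auto simp: U_gens_def)
  define f where "f = scale (sg ((par a + par b) * par c)) (\<Sum>e\<in>idx n.
      scale (scoef (- 1) c e a b * sg (par a + par b)) (gen_elt (Pgen \<alpha> e)))"
  have "Poly_Mapping.keys (\<Sum>e\<in>D. scale (t e) (gen_elt (Pgen \<alpha> e))) \<subseteq> (\<lambda>g. Word [g]) ` APi_gens l n"
    if "D \<subseteq> idx n" for D and t :: "int \<Rightarrow> scalar"
    using that
  proof (induction D rule: infinite_finite_induct)
    case (insert e D)
    then have "Poly_Mapping.keys (scale (t e) (gen_elt (Pgen \<alpha> e))) \<subseteq> (\<lambda>g. Word [g]) ` APi_gens l n"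
      using \<alpha>c by (auto simp: gen_elt_def APi_gens_def)
    with insert show ?case
      using keys_add[of "scale (t e) (gen_elt (Pgen \<alpha> e))"] by fastforce
  qed auto
  from this[OF order_refl] have keys: "Poly_Mapping.keys f \<subseteq> (\<lambda>g. Word [g]) ` APi_gens l n"
    unfolding f_def by (rule order_trans[OF keys_scale])
  have "\<Phi> (L_elt n a b) (A.cl (tau_gen g)) = A.cl (subst tau_gen f)"
  proof -
    have gen: "gen_elt (Tgen \<alpha> e) \<in> carrier A.FF" if "e \<in> idx n" for e
      using that \<alpha>c by (intro free_alg_closed) (auto simp: A_gens_def neg_idx_iff)
    have module: "supermodule (Uq n) A.QQ \<Phi>"
      using A_action by (simp add: supermodule_superalgebra_def)
    have "\<Phi> (L_elt n a b) (A.cl (tau_gen g)) = sg (par (- c)) \<odot>\<^bsub>A.QQ\<^esub> \<Phi> (L_elt n a b) (A.cl (gen_elt (Tgen \<alpha> (- c))))"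
      using \<alpha>c supermoduleD(7)[OF module L_elt_closed[OF ab] A.cl_closed[OF gen[of "- c"]]]
      by (simp add: A.cl_scale gen)
    also have "\<dots> = A.cl (scale (sg (par (- c))) (scale (sg ((par a + par b) * (1 + par (- c)))) (\<Sum>e\<in>idx n.
        scale (scoef (- 1) (- c) e a b) (gen_elt (Tgen \<alpha> e)))))"
      using Phi_bar_generator[OF assms(1) \<alpha>c(2) _ ab, of "- c"] \<alpha>c(3) gen
      by (simp only: A_cls_def idx_simps) (intro A.cl_scale free_alg_scale_closed free_alg_sum_closed gen)
    \<comment> \<open>This is the commutation of the inverse of \<open>S\<close> with
      \<open>J \<otimes> 1\<close> in coordinates.\<close>
    also have "(\<Sum>e\<in>idx n. scale (scoef (- 1) (- c) e a b) (gen_elt (Tgen \<alpha> e))) =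
        (\<Sum>e\<in>idx n. scale (scoef (- 1) c e a b) (gen_elt (Tgen \<alpha> (- e))))"
      by (rule trans[OF sum_idx_uminus[symmetric]]) (simp add: scoef_uminus_left)
    also have "scale (sg (par (- c))) (scale (sg ((par a + par b) * (1 + par (- c))))
        (\<Sum>e\<in>idx n. scale (scoef (- 1) c e a b) (gen_elt (Tgen \<alpha> (- e))))) = subst tau_gen f"
      unfolding f_def subst_linear subst_gen_elt tau_gen.simps scale_sum scale_scale
    proof (intro sum.cong refl arg_cong2[where f = scale], goal_cases)
      case e: (1 e)
      note nz = idx_nonzero[OF e] idx_nonzero[OF \<alpha>c(3)] idx_nonzero[OF ab'(1)] idx_nonzero[OF ab'(2)]
      \<comment> \<open>The exponents differ by \<open>|a| + |b| + |c| + |e|\<close>, which is zero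
        wherever the coefficient is not.\<close>
      have "scoef (- 1) c e a b * (sg (par (- c)) * sg ((par a + par b) * (1 + par (- c)))) =
        scoef (- 1) c e a b * (sg ((par a + par b) * par c) * sg (par a + par b) * sg (par (- e)))"
        by (rule scoef_par_cong[OF nz(2,1,3,4)], cases "par a"; cases "par b"; cases "par c"; cases "par e")
          (simp_all add: par_uminus nz)
      then show ?case
        by (simp only: ac_simps)
    qed
    finally show ?thesis .
  qed
  moreover have "\<Phi>\<pi> (L_elt n a b) (cls (APi_gens l n) (APi_rels l n) (gen_elt g)) = cls (APi_gens l n) (APi_rels l n) f"
    using Phi_bar_pi_generator[OF assms(2) \<alpha>c(2,3) ab] \<alpha>c(1) by (simp add: APi_cls_def f_def)
  ultimately show "\<exists>f. Poly_Mapping.keys f \<subseteq> (\<lambda>g. Word [g]) ` APi_gens l n \<and>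
      \<Phi>\<pi> (L_elt n a b) (cls (APi_gens l n) (APi_rels l n) (gen_elt g)) = cls (APi_gens l n) (APi_rels l n) f \<and>
      \<Phi> (L_elt n a b) (A.cl (tau_gen g)) = A.cl (subst tau_gen f)"
    using keys by blast
qed

text \<open>The actions are any two that meet their characterizations; the witness
  \<open>tau l n\<close> is built from the presentations alone and intertwines every such
  pair.\<close>

theorem proposition4p9:
  fixes l n :: nat
    and \<Phi> \<Phi>\<pi> :: "free set \<Rightarrow> free set \<Rightarrow> free set"
  assumes "l \<ge> 1" and "n \<ge> 1"
    and "is_Phi_bar l n \<Phi>"
    and "is_Phi_bar_pi l n \<Phi>\<pi>"
  shows "\<exists>\<tau>. supermodule_superalgebra_iso n (APi_bar l n) \<Phi>\<pi> (A_bar l n) \<Phi> \<tau> \<and>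
    (\<forall>\<alpha>\<in>neg_idx l. \<forall>b\<in>idx n.
       \<tau> (APi_cls l n (entry (Tcheck_minus l n) [(b, \<alpha>)])) =
       A_cls l n (entry (place 2 [1] (Jmat n) \<bullet>\<^sub>T Tbar_minus l n) [(b, \<alpha>)]))"
proof (intro exI conjI ballI)
  interpret equivariance "APi_gens l n" "APi_rels l n" "A_gens l n" "A_rels l n" tau_gen n \<Phi>\<pi> \<Phi>
    by (rule tau_equivariance) (use assms in blast)+
  note bar = APi_bar_def[symmetric] A_bar_def[symmetric]
  show "supermodule_superalgebra_iso n (APi_bar l n) \<Phi>\<pi> (A_bar l n) \<Phi> (tau l n)"
    unfolding supermodule_superalgebra_iso_def
    using tau_ring_iso[of l n] induced_smult[unfolded bar, folded tau_def] induced_part[unfolded bar, folded tau_def]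
      equivariant[unfolded bar, folded tau_def] by blast
  fix \<alpha> b assume \<alpha>b: "\<alpha> \<in> neg_idx l" "b \<in> idx n"
  then have "gen_elt (Pgen \<alpha> b) \<in> carrier P.FF"
    by (intro free_alg_closed) (auto simp: APi_gens_def)
  then have "tau l n (APi_cls l n (gen_elt (Pgen \<alpha> b))) = A_cls l n (tau_gen (Pgen \<alpha> b))"
    by (simp only: tau_def APi_cls_def A_cls_def induced_cl subst_gen_elt)
  then show "tau l n (APi_cls l n (entry (Tcheck_minus l n) [(b, \<alpha>)])) =
      A_cls l n (entry (place 2 [1] (Jmat n) \<bullet>\<^sub>T Tbar_minus l n) [(b, \<alpha>)])"
    using \<alpha>b unfolding entry_JT[OF \<alpha>b] by (simp add: Tcheck_minus_eq entry_tmat del: tau_gen.simps)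
qed

end
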